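(* Let $s\in(\tfrac14,1)$ be fixed. There exists a constant $C_4>0$ such that $$\|f\|_{L^4_{per}}^4\le C_4\,\|(-\Delta)^{\frac s2}f\|_{L^2_{per}}^{\frac1s}\,\|f\|_{L^2_{per}}^{4-\frac1s}+C_4\,\|f\|_{L^2_{per}}^4$$ for all $f\in H^s_{per}$.
   Context: All spaces are spaces of $2\pi$-periodic functions on $\mathbb{T}=[-\pi,\pi]$. $H^s_{per}$ consists of periodic distributions $f$ with $\|f\|_{H^s_{per}}^2=2\pi\sum_{k\in\mathbb{Z}}(1+k^2)^s|\widehat f(k)|^2<\infty$, where $\widehat f(k)$ are the Fourier coefficients, and $L^2_{per}=H^0_{per}$. The operator $(-\Delta)^{s/2}$ is defined by $\widehat{(-\Delta)^{s/2}f}(k)=|k|^s\widehat f(k)$, $k\in\mathbb{Z}$. *)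

theory Defs
  imports "HOL-Analysis.Analysis"
begin

text \<open>Test functions: smooth, 2 pi-periodic, complex-valued functions of a real variable.\<close>

definition nderiv :: "nat \<Rightarrow> (real \<Rightarrow> complex) \<Rightarrow> real \<Rightarrow> complex" where
  "nderiv n \<phi> = ((\<lambda>g x. vector_derivative g (at x)) ^^ n) \<phi>"

definition per_test :: "(real \<Rightarrow> complex) set" where
  "per_test = {\<phi>. (\<forall>n x. nderiv n \<phi> differentiable (at x)) \<and> (\<forall>x. \<phi> (x + 2 * pi) = \<phi> x)}"

text \<open>
  Periodic distributions are the linear functionals on test functions that are continuous for
  the Frechet topology, i.e. bounded by finitely many of the seminorms given by the suprema of the
  derivatives. A functional is set to 0 outside the test functions, so that two distributions
  are equal as HOL functions iff they agree on all test functions.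
\<close>

definition per_distr :: "((real \<Rightarrow> complex) \<Rightarrow> complex) set" where
  "per_distr = {u.
     (\<forall>\<phi>\<in>per_test. \<forall>\<psi>\<in>per_test. u (\<lambda>x. \<phi> x + \<psi> x) = u \<phi> + u \<psi>) \<and>
     (\<forall>c. \<forall>\<phi>\<in>per_test. u (\<lambda>x. c * \<phi> x) = c * u \<phi>) \<and>
     (\<exists>C N. \<forall>\<phi>\<in>per_test. norm (u \<phi>) \<le> C * (\<Sum>j\<le>N. SUP x\<in>{-pi..pi}. norm (nderiv j \<phi> x))) \<and>
     (\<forall>\<phi>. \<phi> \<notin> per_test \<longrightarrow> u \<phi> = 0)}"

definition fourier_coeff :: "((real \<Rightarrow> complex) \<Rightarrow> complex) \<Rightarrow> int \<Rightarrow> complex" where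
  "fourier_coeff u k = u (\<lambda>x. cis (- (of_int k * x))) / (2 * of_real pi)"

definition H_per :: "real \<Rightarrow> ((real \<Rightarrow> complex) \<Rightarrow> complex) set" where
  "H_per s = {u \<in> per_distr.
     (\<lambda>k::int. (1 + (of_int k)\<^sup>2) powr s * (norm (fourier_coeff u k))\<^sup>2) summable_on UNIV}"

definition H_norm :: "real \<Rightarrow> ((real \<Rightarrow> complex) \<Rightarrow> complex) \<Rightarrow> real" where
  "H_norm s u =
     sqrt (2 * pi * (\<Sum>\<^sub>\<infinity>k::int. (1 + (of_int k)\<^sup>2) powr s * (norm (fourier_coeff u k))\<^sup>2))"

abbreviation L2_norm :: "((real \<Rightarrow> complex) \<Rightarrow> complex) \<Rightarrow> real" where
  "L2_norm \<equiv> H_norm 0"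

text \<open>
  The operator \<open>(-\<Delta>)\<^bsup>s/2\<^esup>\<close>, for \<open>s > 0\<close> (so that \<open>0 powr s = 0\<close> is the right value at frequency 0).
  A periodic distribution is determined by its Fourier coefficients, which justifies the
  definite description.
\<close>

definition frac_lap_half :: "real \<Rightarrow> ((real \<Rightarrow> complex) \<Rightarrow> complex) \<Rightarrow> (real \<Rightarrow> complex) \<Rightarrow> complex" where
  "frac_lap_half s u = (THE v. v \<in> per_distr \<and>
     (\<forall>k. fourier_coeff v k = of_real (\<bar>of_int k\<bar> powr s) * fourier_coeff u k))"

text \<open>
  A distribution belongs to \<open>L\<^sup>p\<close> if it is integration against a \<open>p\<close>-integrable periodic function.
  That function is unique up to null sets, so the norm does not depend on the choice.
\<close>

definition Lp_represents :: "real \<Rightarrow> (real \<Rightarrow> complex) \<Rightarrow> ((real \<Rightarrow> complex) \<Rightarrow> complex) \<Rightarrow> bool" where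
  "Lp_represents p g u \<longleftrightarrow>
     g \<in> borel_measurable borel \<and> (\<forall>x. g (x + 2 * pi) = g x) \<and>
     set_integrable lborel {-pi..pi} g \<and>
     set_integrable lborel {-pi..pi} (\<lambda>x. norm (g x) powr p) \<and>
     (\<forall>\<phi>\<in>per_test. u \<phi> = (LINT x:{-pi..pi}|lborel. g x * \<phi> x))"

definition Lp_per :: "real \<Rightarrow> ((real \<Rightarrow> complex) \<Rightarrow> complex) set" where
  "Lp_per p = {u \<in> per_distr. \<exists>g. Lp_represents p g u}"

definition Lp_norm :: "real \<Rightarrow> ((real \<Rightarrow> complex) \<Rightarrow> complex) \<Rightarrow> real" where
  "Lp_norm p u =
     (LINT x:{-pi..pi}|lborel. norm ((SOME g. Lp_represents p g u) x) powr p) powr (1 / p)"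

text \<open>The exponentials are test functions, so \<^const>\<open>fourier_coeff\<close> never sees the default value 0.\<close>

lemma has_vector_derivative_cis_mult:
  "((\<lambda>x. c * cis (a * x)) has_vector_derivative c * (\<i> * of_real a) * cis (a * x)) (at x)"
proof -
  have "((\<lambda>z. c * exp (\<i> * of_real a * z)) has_field_derivative
          c * (\<i> * of_real a) * exp (\<i> * of_real a * of_real x)) (at (of_real x))"
    by (auto intro!: derivative_eq_intros)
  from has_vector_derivative_real_field[OF this] show ?thesis
    by (simp add: cis_conv_exp mult.assoc)
qed

lemma nderiv_cis: "nderiv n (\<lambda>x. cis (a * x)) = (\<lambda>x. (\<i> * of_real a) ^ n * cis (a * x))"
proof (induction n)
  case 0
  then show ?case by (simp add: nderiv_def)
next
  case (Suc n)
  have "nderiv (Suc n) (\<lambda>x. cis (a * x)) =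
          (\<lambda>x. vector_derivative (nderiv n (\<lambda>x. cis (a * x))) (at x))"
    by (simp add: nderiv_def)
  also have "\<dots> = (\<lambda>x. (\<i> * of_real a) ^ n * (\<i> * of_real a) * cis (a * x))"
    unfolding Suc by (intro ext vector_derivative_at has_vector_derivative_cis_mult)
  finally show ?case by (simp add: mult_ac)
qed

lemma cis_per_test: "(\<lambda>x. cis (- (of_int k * x))) \<in> per_test"
proof -
  have "nderiv n (\<lambda>x. cis (- of_int k * x)) differentiable (at x)" for n x
    unfolding nderiv_cis by (rule differentiableI_vector[OF has_vector_derivative_cis_mult])
  moreover have "cis (- (of_int k * (x + 2 * pi))) = cis (- (of_int k * x))" for x
  proof -
    have "cis (- (of_int k * (x + 2 * pi))) = cis (- (of_int k * x)) * cis (2 * pi * of_int (- k))"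
      by (simp add: cis_mult algebra_simps)
    also have "cis (2 * pi * of_int (- k)) = 1"
      by (rule cis_multiple_2pi) auto
    finally show ?thesis by simp
  qed
  ultimately show ?thesis by (simp add: per_test_def)
qed

end

theory Submission
  imports Defs
begin

text \<open>
  Let \<open>a\<^sub>k\<close> be the Fourier coefficients of \<open>f\<close>, let \<open>X\<close> be the \<open>L\<^sup>2\<close> norm of \<open>f\<close> and \<open>Y\<close> that of
  \<open>(-\<Delta>)\<^bsup>s/2\<^esup> f\<close>. The inequality holds for two reasons.

  First, the \<open>L\<^sup>4\<close> norm of a function is governed by the \<open>\<ell>\<^sup>4\<^sup>/\<^sup>3\<close> norm of its coefficients. The square of a
  trigonometric sum has the convolution \<open>a * a\<close> as coefficients, so Parseval's identity turns
  the \<open>L\<^sup>4\<close> norm into the \<open>\<ell>\<^sup>2\<close> norm of \<open>a * a\<close>, and Young's convolution inequality gives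
  \<open>\<parallel>S\<parallel>\<^sub>4\<^sup>4 \<le> 2 \<pi> (\<Sum> \<bar>a\<^sub>k\<bar>\<^sup>4\<^sup>/\<^sup>3)\<^sup>3\<close> (\<open>integral_trig_sum_fourth_power_le\<close>).

  Second, \<open>\<Sum> \<bar>a\<^sub>k\<bar>\<^sup>4\<^sup>/\<^sup>3\<close> interpolates between \<open>X\<close> and \<open>Y\<close>. Frequencies below
  \<open>M \<approx> max 1 ((Y / X)\<^sup>1\<^sup>/\<^sup>s)\<close> are estimated by \<open>X\<close> and their number, higher ones by \<open>Y\<close> and the tail of
  \<open>\<Sum> \<bar>k\<bar>\<^sup>-\<^sup>4\<^sup>s\<close>, which converges because \<open>s > 1/4\<close>. Both parts contribute at most a multiple of
  \<open>M X\<^sup>4\<close> to the cube of the sum, which is of the order of \<open>X\<^sup>4 + Y\<^sup>1\<^sup>/\<^sup>s X\<^sup>4\<^sup>-\<^sup>1\<^sup>/\<^sup>s\<close> (\<open>sum_fourth_power_cube_le\<close>).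

  These bounds hold for all partial sums of the Fourier series. By \<open>riesz_fischer\<close>, a subsequence of the
  partial sums converges almost everywhere to an integrable function \<open>g\<close> with coefficients \<open>a\<^sub>k\<close>,
  and Fatou's lemma transfers the bound to \<open>g\<close>.

  It remains to relate \<open>g\<close> to the distribution \<open>f\<close>. A periodic distribution is determined by
  its Fourier coefficients (\<open>per_distr_eqI\<close>), because trigonometric polynomials are dense in the
  test functions together with any number of derivatives. Hence \<open>f\<close> is integration against \<open>g\<close>, and
  the fractional Laplacian is well defined. The \<open>L\<^sup>4\<close> norm of \<open>f\<close> refers to an arbitrary function
  representing \<open>f\<close>; this function agrees with \<open>g\<close> almost everywhere, since an integrable
  function with vanishing coefficients vanishes almost everywhere
  (\<open>AE_eq_0_if_fourier_coeffs_0\<close>).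
\<close>

section \<open>Estimates for finite families of coefficients\<close>

text \<open>
  Young's inequality \<open>\<parallel>a * a\<parallel>\<^sub>2 \<le> \<parallel>a\<parallel>\<^sub>p\<^sup>2\<close> for the exponent \<open>p = 4/3\<close>, written for
  \<open>c\<^sub>k = \<bar>a\<^sub>k\<bar>\<^sup>1\<^sup>/\<^sup>3\<close> so that only integer powers occur: \<open>\<bar>a\<^sub>k\<bar> = c\<^sub>k\<^sup>3\<close> and
  \<open>\<bar>a\<^sub>k\<bar>\<^sup>4\<^sup>/\<^sup>3 = c\<^sub>k\<^sup>4\<close>. Splitting \<open>c\<^sup>3 c'\<^sup>3 = (c\<^sup>2 c'\<^sup>2) (c c')\<close> before applying Cauchy--Schwarz makes
  the first factor a convolution of fourth powers, which can be summed over \<open>n\<close>, and bounds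
  the second factor uniformly in \<open>n\<close>.
\<close>

lemma sum_convolution_le:
  fixes c :: "int \<Rightarrow> real"
  assumes A: "finite A" and B: "finite B" and nonneg: "\<And>k. 0 \<le> c k"
    and supp: "\<And>k. k \<notin> A \<Longrightarrow> c k = 0"
  shows "(\<Sum>n\<in>B. (\<Sum>k\<in>A. c k ^ 3 * c (n - k) ^ 3)\<^sup>2) \<le> (\<Sum>k\<in>A. c k ^ 4) ^ 3"
proof -
  define Q where "Q = (\<Sum>k\<in>A. c k ^ 4)"
  have Q0: "0 \<le> Q" unfolding Q_def by (intro sum_nonneg) (simp add: nonneg)
  have shifted: "(\<Sum>k\<in>I. c (h k) ^ 4) \<le> Q" if "inj_on h I" "finite I" for h and I :: "int set"
  proof -
    have "(\<Sum>k\<in>I. c (h k) ^ 4) = (\<Sum>k\<in>h ` I. c k ^ 4)"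
      by (simp add: sum.reindex[OF that(1)] o_def)
    also have "\<dots> = (\<Sum>k\<in>h ` I \<inter> A. c k ^ 4)"
      by (rule sum.mono_neutral_right) (use that supp in auto)
    also have "\<dots> \<le> Q"
      unfolding Q_def by (rule sum_mono2) (use A nonneg in auto)
    finally show ?thesis .
  qed
  have step: "(\<Sum>k\<in>A. c k ^ 3 * c (n - k) ^ 3)\<^sup>2 \<le> (\<Sum>k\<in>A. c k ^ 4 * c (n - k) ^ 4) * Q" for n
  proof -
    have "(\<Sum>k\<in>A. c k ^ 3 * c (n - k) ^ 3)\<^sup>2 =
        (\<Sum>k\<in>A. (c k ^ 2 * c (n - k) ^ 2) * (c k * c (n - k)))\<^sup>2"
      by (simp add: power2_eq_square power3_eq_cube mult_ac)
    also have "\<dots> \<le> (\<Sum>k\<in>A. (c k ^ 2 * c (n - k) ^ 2)\<^sup>2) * (\<Sum>k\<in>A. (c k * c (n - k))\<^sup>2)"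
      by (rule Cauchy_Schwarz_ineq_sum)
    also have "(\<Sum>k\<in>A. (c k ^ 2 * c (n - k) ^ 2)\<^sup>2) = (\<Sum>k\<in>A. c k ^ 4 * c (n - k) ^ 4)"
      by (simp add: power_mult_distrib flip: power_mult)
    also have "(\<Sum>k\<in>A. (c k * c (n - k))\<^sup>2) \<le> (\<Sum>k\<in>A. (c k ^ 4 + c (n - k) ^ 4) / 2)"
    proof (rule sum_mono)
      fix k
      have "0 \<le> (c k ^ 2 - c (n - k) ^ 2)\<^sup>2" by simp
      then show "(c k * c (n - k))\<^sup>2 \<le> (c k ^ 4 + c (n - k) ^ 4) / 2"
        by (simp add: power2_diff power_mult_distrib flip: power_mult)
    qed
    also have "\<dots> = (Q + (\<Sum>k\<in>A. c (n - k) ^ 4)) / 2"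
      by (simp add: Q_def sum.distrib flip: sum_divide_distrib)
    also have "\<dots> \<le> Q"
      using shifted[of "\<lambda>k. n - k" A] A by (simp add: inj_on_def)
    finally show ?thesis
      by (simp add: mult_left_mono sum_nonneg nonneg)
  qed
  have "(\<Sum>n\<in>B. (\<Sum>k\<in>A. c k ^ 3 * c (n - k) ^ 3)\<^sup>2) \<le>
      (\<Sum>n\<in>B. (\<Sum>k\<in>A. c k ^ 4 * c (n - k) ^ 4) * Q)"
    by (intro sum_mono step)
  also have "\<dots> = (\<Sum>k\<in>A. c k ^ 4 * (\<Sum>n\<in>B. c (n - k) ^ 4)) * Q"
    by (simp add: sum_distrib_left sum_distrib_right sum.swap[of _ A B])
  also have "\<dots> \<le> (\<Sum>k\<in>A. c k ^ 4 * Q) * Q"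
    using shifted[OF _ B] Q0 by (intro mult_right_mono sum_mono mult_left_mono) (auto simp: inj_on_def nonneg)
  also have "\<dots> = Q ^ 3"
    by (simp add: Q_def power3_eq_cube flip: sum_distrib_right)
  finally show ?thesis by (simp add: Q_def)
qed

lemma summable_Suc_powr:
  assumes "p > (1::real)"
  shows "summable (\<lambda>q. real (Suc q) powr - p)"
  using assms by (subst summable_Suc_iff) (simp add: summable_real_powr_iff)

text \<open>
  The weight is constant on blocks of \<open>M\<close> consecutive values of \<open>\<bar>k\<bar>\<close>, so that each value is
  taken at most \<open>2 M\<close> times. Rounding \<open>\<bar>k\<bar> / M\<close> down is what reduces the sum to a multiple of
  the zeta series, with no comparison of sums and integrals.
\<close>

lemma sum_block_weights_le:
  fixes p :: real and M :: nat
  assumes "finite A" "M > 0" "p > 1"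
  shows "(\<Sum>k\<in>A. (1 + real (nat \<bar>k\<bar> div M)) powr - p) \<le> 2 * real M * (\<Sum>q. real (Suc q) powr - p)"
proof -
  define q where "q k = nat \<bar>k\<bar> div M" for k :: int
  have card: "card {k \<in> A. q k = j} \<le> 2 * M" for j
  proof -
    have "{k \<in> A. q k = j} \<subseteq> int ` {j * M..<j * M + M} \<union> (\<lambda>i. - int i) ` {j * M..<j * M + M}"
    proof
      fix k assume "k \<in> {k \<in> A. q k = j}"
      then have "nat \<bar>k\<bar> \<in> {j * M..<j * M + M}"
        using \<open>M > 0\<close> by (auto simp: q_def dividend_less_div_times add.commute)
      moreover have "k = int (nat \<bar>k\<bar>) \<or> k = - int (nat \<bar>k\<bar>)" by auto
      ultimately show "k \<in> int ` {j * M..<j * M + M} \<union> (\<lambda>i. - int i) ` {j * M..<j * M + M}"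
        by blast
    qed
    then have "card {k \<in> A. q k = j} \<le>
        card (int ` {j * M..<j * M + M} \<union> (\<lambda>i. - int i) ` {j * M..<j * M + M})"
      by (intro card_mono) auto
    also have "\<dots> \<le> M + M"
      by (intro order.trans[OF card_Un_le] add_mono order.trans[OF card_image_le]) auto
    finally show ?thesis by simp
  qed
  have "(\<Sum>k\<in>A. (1 + real (nat \<bar>k\<bar> div M)) powr - p) = (\<Sum>k\<in>A. real (Suc (q k)) powr - p)"
    by (simp add: q_def)
  also have "\<dots> = (\<Sum>j\<in>q ` A. real (card {k \<in> A. q k = j}) * real (Suc j) powr - p)"
    using assms by (subst sum_fun_comp[of A "q ` A" q "\<lambda>j. real (Suc j) powr - p"]) auto
  also have "\<dots> \<le> (\<Sum>j\<in>q ` A. real (2 * M) * real (Suc j) powr - p)"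
    by (intro sum_mono mult_right_mono) (use card in \<open>auto simp del: of_nat_mult\<close>)
  also have "\<dots> = 2 * real M * (\<Sum>j\<in>q ` A. real (Suc j) powr - p)"
    by (simp add: sum_distrib_left)
  also have "\<dots> \<le> 2 * real M * (\<Sum>j. real (Suc j) powr - p)"
    using assms by (intro mult_left_mono sum_le_suminf summable_Suc_powr) auto
  finally show ?thesis .
qed

text \<open>
  The interpolation step. With \<open>c\<^sub>k\<^sup>3 = \<bar>a\<^sub>k\<bar>\<close>, the sixth powers are the squares \<open>\<bar>a\<^sub>k\<bar>\<^sup>2\<close>, and \<open>X\<close>, \<open>Y\<close>
  bound the norms of \<open>a\<close> and of \<open>\<bar>k\<bar>\<^sup>s a\<close>. These two norms balance at the frequency
  \<open>M \<approx> (Y / X)\<^sup>1\<^sup>/\<^sup>s\<close>. A weight \<open>w\<close> growing like \<open>(\<bar>k\<bar> / M)\<^sup>2\<^sup>s\<close> beyond \<open>M\<close> keeps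
  \<open>\<Sum> w \<bar>a\<bar>\<^sup>2\<close> below a multiple of \<open>X\<^sup>2\<close>, while \<open>\<Sum> w\<^sup>-\<^sup>2\<close> is at most a multiple of \<open>M\<close> because
  \<open>4 s > 1\<close>. Hoelder's inequality would then give \<open>(\<Sum> c\<^sup>4)\<^sup>3 \<le> (\<Sum> w \<bar>a\<bar>\<^sup>2)\<^sup>2 (\<Sum> w\<^sup>-\<^sup>2)\<close>, which is of the
  order of \<open>M X\<^sup>4\<close>; a scaled form of Young's inequality for numbers does the same here, up to the constant.
\<close>

lemma sum_fourth_power_cube_le:
  fixes c :: "int \<Rightarrow> real" and s :: real
  assumes s: "1 / 4 < s" "s < 1"
  defines "\<zeta> \<equiv> \<Sum>q. real (Suc q) powr - (4 * s)"
  assumes A: "finite A" and nonneg: "\<And>k. 0 \<le> c k" and X: "0 \<le> X" and Y: "0 \<le> Y"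
    and X2: "(\<Sum>k\<in>A. c k ^ 6) \<le> X\<^sup>2"
    and Y2: "(\<Sum>k\<in>A. \<bar>of_int k\<bar> powr (2 * s) * c k ^ 6) \<le> Y\<^sup>2"
  shows "(\<Sum>k\<in>A. c k ^ 4) ^ 3 \<le>
    2 * (8 + 2 * \<zeta>) ^ 3 * (X ^ 4 + Y powr (1 / s) * X powr (4 - 1 / s))"
proof (cases "X = 0")
  case True
  then have "c k = 0" if "k \<in> A" for k
    using X2 sum_nonneg_eq_0_iff[OF A, of "\<lambda>k. c k ^ 6"] that nonneg
    by (simp add: antisym sum_nonneg)
  then have "(\<Sum>k\<in>A. c k ^ 4) = 0" by simp
  then show ?thesis using True by simp
next
  case False
  then have X0: "X > 0" using X by simp
  have \<zeta>0: "0 \<le> \<zeta>" unfolding \<zeta>_def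
    using s by (intro suminf_nonneg summable_Suc_powr) auto
  \<comment> \<open>The maximum with 1 produces the additional term \<open>X\<^sup>4\<close>; it is what makes \<open>M \<le> 2 N\<close>.\<close>
  define N where "N = max 1 ((Y / X) powr (1 / s))"
  define M where "M = nat \<lceil>N\<rceil>"
  have "N \<ge> 1" by (simp add: N_def)
  then have NM: "N \<le> real M" and M2: "real M \<le> 2 * N" and M1: "1 \<le> M"
    unfolding M_def by linarith+
  have "N \<le> 1 + (Y / X) powr (1 / s)" by (simp add: N_def)
  with M2 have M3: "real M \<le> 2 * (1 + (Y / X) powr (1 / s))" by simp
  define w where "w k = (1 + real (nat \<bar>k\<bar> div M)) powr (2 * s)" for k :: int
  have w0: "w k > 0" for k by (simp add: w_def add_pos_nonneg)
  have YM: "Y\<^sup>2 \<le> X\<^sup>2 * real M powr (2 * s)"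
  proof -
    have "Y / X = ((Y / X) powr (1 / s)) powr s" using s X0 Y by (simp add: powr_powr)
    also have "\<dots> \<le> real M powr s"
      using NM s by (intro powr_mono2) (auto simp: N_def)
    finally have "(Y / X)\<^sup>2 \<le> (real M powr s)\<^sup>2"
      using X0 Y by (intro power_mono) auto
    also have "\<dots> = real M powr (2 * s)"
      using M1 by (simp add: power2_eq_square flip: powr_add)
    finally show ?thesis using X0 by (simp add: power_divide field_simps)
  qed
  have w_le: "w k \<le> 4 * (1 + \<bar>of_int k\<bar> powr (2 * s) / real M powr (2 * s))" for k
  proof -
    have "real (nat \<bar>k\<bar> div M) \<le> \<bar>of_int k\<bar> / real M"
      using of_nat_div_le_of_nat[of "nat \<bar>k\<bar>" M, where ?'a = real] by simp
    then have "1 + real (nat \<bar>k\<bar> div M) \<le> 2 * max 1 (\<bar>of_int k\<bar> / real M)" by simp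
    then have "w k \<le> (2 * max 1 (\<bar>of_int k\<bar> / real M)) powr (2 * s)"
      unfolding w_def using s by (intro powr_mono2) auto
    also have "\<dots> = 2 powr (2 * s) * max 1 (\<bar>of_int k\<bar> / real M) powr (2 * s)"
      by (simp add: powr_mult)
    also have "\<dots> \<le> 2 powr 2 * (1 + \<bar>of_int k\<bar> powr (2 * s) / real M powr (2 * s))"
      using s by (intro mult_mono powr_mono) (auto simp: max_def powr_divide)
    finally show ?thesis by simp
  qed
  have "(\<Sum>k\<in>A. w k * c k ^ 6) \<le>
      (\<Sum>k\<in>A. 4 * (1 + \<bar>of_int k\<bar> powr (2 * s) / real M powr (2 * s)) * c k ^ 6)"
    by (intro sum_mono mult_right_mono w_le) (simp add: nonneg)
  also have "\<dots> = 4 * ((\<Sum>k\<in>A. c k ^ 6) +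
      (\<Sum>k\<in>A. \<bar>of_int k\<bar> powr (2 * s) * c k ^ 6) / real M powr (2 * s))"
    by (simp add: sum.distrib sum_distrib_left sum_divide_distrib algebra_simps)
  also have "\<dots> \<le> 4 * (X\<^sup>2 + Y\<^sup>2 / real M powr (2 * s))"
    using X2 Y2 by (intro mult_left_mono add_mono divide_right_mono) auto
  also have "\<dots> \<le> 8 * X\<^sup>2" using YM M1 by (simp add: field_simps)
  finally have w6: "(\<Sum>k\<in>A. w k * c k ^ 6) \<le> 8 * X\<^sup>2" .
  have "(\<Sum>k\<in>A. 1 / (w k)\<^sup>2) = (\<Sum>k\<in>A. (1 + real (nat \<bar>k\<bar> div M)) powr - (4 * s))"
    unfolding w_def by (intro sum.cong refl)
      (simp add: power2_eq_square powr_minus field_simps flip: powr_add)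
  also have "\<dots> \<le> 2 * real M * \<zeta>"
    unfolding \<zeta>_def using s M1 A by (intro sum_block_weights_le) auto
  finally have wm: "(\<Sum>k\<in>A. 1 / (w k)\<^sup>2) \<le> 2 * real M * \<zeta>" .
  \<comment> \<open>The scale that equalises the two sums in the weighted inequality \<open>young\<close>.\<close>
  define r where "r = root 3 (real M / X\<^sup>2)"
  have r0: "r > 0" and r3: "r ^ 3 = real M / X\<^sup>2" using X0 M1 by (simp_all add: r_def)
  have young: "c k ^ 4 \<le> r * (w k * c k ^ 6) + (1 / r\<^sup>2) * (1 / (w k)\<^sup>2)" for k
  proof -
    define t where "t = r * w k * (c k)\<^sup>2"
    have t0: "0 \<le> t" using r0 w0[of k] by (simp add: t_def)
    have "t\<^sup>2 \<le> t ^ 3 + 1"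
    proof (cases "t \<le> 1")
      case True
      then show ?thesis using t0 by (simp add: power_le_one add_increasing)
    next
      case False
      then have "t\<^sup>2 \<le> t ^ 3" by (intro power_increasing) auto
      then show ?thesis by simp
    qed
    then have "t\<^sup>2 / (r * w k)\<^sup>2 \<le> (t ^ 3 + 1) / (r * w k)\<^sup>2"
      by (intro divide_right_mono) auto
    then show ?thesis
      using r0 w0[of k] by (simp add: t_def power_mult_distrib add_divide_distrib
          power2_eq_square power3_eq_cube eval_nat_numeral mult_ac)
  qed
  have "(\<Sum>k\<in>A. c k ^ 4) \<le> (\<Sum>k\<in>A. r * (w k * c k ^ 6) + (1 / r\<^sup>2) * (1 / (w k)\<^sup>2))"
    by (intro sum_mono young)
  also have "\<dots> = r * (\<Sum>k\<in>A. w k * c k ^ 6) + (1 / r\<^sup>2) * (\<Sum>k\<in>A. 1 / (w k)\<^sup>2)"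
    by (simp add: sum.distrib sum_distrib_left)
  also have "\<dots> \<le> r * (8 * X\<^sup>2) + (1 / r\<^sup>2) * (2 * real M * \<zeta>)"
    using r0 w6 wm by (intro add_mono mult_left_mono) auto
  also have "real M = r ^ 3 * X\<^sup>2" using r3 X0 by simp
  also have "r * (8 * X\<^sup>2) + (1 / r\<^sup>2) * (2 * (r ^ 3 * X\<^sup>2) * \<zeta>) = (8 + 2 * \<zeta>) * (r * X\<^sup>2)"
    using r0 by (simp add: field_simps power2_eq_square power3_eq_cube)
  finally have "(\<Sum>k\<in>A. c k ^ 4) ^ 3 \<le> ((8 + 2 * \<zeta>) * (r * X\<^sup>2)) ^ 3"
    by (intro power_mono) (simp_all add: sum_nonneg nonneg)
  also have "\<dots> = (8 + 2 * \<zeta>) ^ 3 * (real M * X ^ 4)"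
    using X0 by (simp add: power_mult_distrib r3 flip: power_mult)
      (simp add: field_simps eval_nat_numeral)
  also have "\<dots> \<le> (8 + 2 * \<zeta>) ^ 3 * (2 * (1 + (Y / X) powr (1 / s)) * X ^ 4)"
    using M3 \<zeta>0 by (intro mult_left_mono mult_right_mono) auto
  also have "\<dots> = 2 * (8 + 2 * \<zeta>) ^ 3 * (X ^ 4 + Y powr (1 / s) * (X ^ 4 / X powr (1 / s)))"
    using X0 Y by (simp add: powr_divide field_simps)
  also have "X ^ 4 / X powr (1 / s) = X powr (4 - 1 / s)"
    using X0 by (simp add: powr_diff)
  finally show ?thesis .
qed

section \<open>The torus as a measure space, and trigonometric sums\<close>

definition torus :: "real measure" where
  "torus = restrict_space lborel {-pi..pi}"

lemma set_integrable_torus: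
  fixes f :: "real \<Rightarrow> 'a::{banach, second_countable_topology}"
  shows "set_integrable lborel {-pi..pi} f \<longleftrightarrow> integrable torus f"
  by (simp add: torus_def integrable_restrict_space set_integrable_def)

lemma set_integral_torus:
  fixes f :: "real \<Rightarrow> 'a::{banach, second_countable_topology}"
  shows "(LINT x:{-pi..pi}|lborel. f x) = integral\<^sup>L torus f"
  by (simp add: torus_def integral_restrict_space set_lebesgue_integral_def)

lemma space_torus [simp]: "space torus = {-pi..pi}"
  by (simp add: torus_def space_restrict_space)

lemma emeasure_torus: "emeasure torus (space torus) = ennreal (2 * pi)"
  by (simp add: torus_def space_restrict_space emeasure_restrict_space)

lemma measure_torus [simp]: "measure torus {-pi..pi} = 2 * pi"
  using emeasure_torus by (simp add: measure_def)

interpretation torus: finite_measure torus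
  by (rule finite_measureI) (simp add: emeasure_torus del: space_torus)

lemma measurable_torus: "f \<in> borel_measurable borel \<Longrightarrow> f \<in> borel_measurable torus"
  by (simp add: torus_def measurable_restrict_space1)

definition mode :: "int \<Rightarrow> real \<Rightarrow> complex" where
  "mode k x = cis (of_int k * x)"

lemma norm_mode [simp]: "norm (mode k x) = 1"
  by (simp add: mode_def)

lemma mode_mult: "mode k x * mode l x = mode (k + l) x"
  by (simp add: mode_def cis_mult algebra_simps)

lemma cnj_mode [simp]: "cnj (mode k x) = mode (- k) x"
  by (simp add: mode_def cis_cnj)

lemma mode_0 [simp]: "mode 0 x = 1"
  by (simp add: mode_def)

lemma mode_periodic [simp]: "mode k (x + 2 * pi) = mode k x"
proof -
  have "mode k (x + 2 * pi) = mode k x * cis (2 * pi * of_int k)"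
    by (simp add: mode_def cis_mult algebra_simps)
  also have "cis (2 * pi * of_int k) = 1" by (rule cis_multiple_2pi) auto
  finally show ?thesis by simp
qed

lemma has_vector_derivative_mode:
  "((\<lambda>x. c * mode k x) has_vector_derivative c * (\<i> * of_int k) * mode k x) (at x)"
  using has_vector_derivative_cis_mult[of c "of_int k" x] by (simp add: mode_def)

lemma continuous_mode: "continuous_on A (mode k)"
  unfolding mode_def by (intro continuous_intros)

lemma measurable_mode [measurable]: "mode k \<in> borel_measurable borel"
  by (intro borel_measurable_continuous_onI continuous_mode)

lemma integrable_torus_bounded:
  fixes f :: "real \<Rightarrow> 'a::{banach, second_countable_topology}"
  assumes "f \<in> borel_measurable borel" "\<And>x. x \<in> {-pi..pi} \<Longrightarrow> norm (f x) \<le> B"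
  shows "integrable torus f"
proof (rule torus.integrable_const_bound[of _ B])
  show "AE x in torus. norm (f x) \<le> B"
    using assms(2) by (intro AE_I2) simp
qed (rule measurable_torus[OF assms(1)])

lemma integrable_mult_bounded:
  fixes g \<phi> :: "real \<Rightarrow> complex"
  assumes "integrable torus g" and [measurable]: "\<phi> \<in> borel_measurable borel"
    and "\<And>x. x \<in> {-pi..pi} \<Longrightarrow> norm (\<phi> x) \<le> B"
  shows "integrable torus (\<lambda>x. g x * \<phi> x)"
proof (rule Bochner_Integration.integrable_bound[of torus "\<lambda>x. norm (g x) * B"])
  show "integrable torus (\<lambda>x. norm (g x) * B)" using assms(1) by simp
  show "(\<lambda>x. g x * \<phi> x) \<in> borel_measurable torus"
    using borel_measurable_integrable[OF assms(1)] measurable_torus[OF assms(2)]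
    by (rule borel_measurable_times)
  show "AE x in torus. norm (g x * \<phi> x) \<le> norm (norm (g x) * B)"
    using assms(3) by (intro AE_I2) (simp add: norm_mult abs_mult mult_left_mono order.trans[OF _ abs_ge_self])
qed

lemma integrable_mode [simp]: "integrable torus (mode k)"
  by (rule integrable_torus_bounded[of _ 1]) auto

lemma integral_mode: "integral\<^sup>L torus (mode k) = (if k = 0 then 2 * of_real pi else 0)"
proof (cases "k = 0")
  case True
  then show ?thesis
    by (simp add: mode_def[abs_def] scaleR_conv_of_real)
next
  case False
  define F where "F x = (1 / (\<i> * of_int k)) * mode k x" for x
  have "integral\<^sup>L lborel (\<lambda>x. indicator {-pi..pi} x *\<^sub>R mode k x) = F pi - F (- pi)"
  proof (rule integral_FTC_atLeastAtMost)
    show "(F has_vector_derivative mode k x) (at x within {-pi..pi})" for x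
      using has_vector_derivative_mode[of "1 / (\<i> * of_int k)" k x] False
      unfolding F_def by (auto intro: has_vector_derivative_at_within)
  qed (auto intro: continuous_mode)
  also have "F pi = F (- pi)"
    using mode_periodic[of k "- pi"] by (simp add: F_def)
  finally show ?thesis
    using False by (simp add: torus_def integral_restrict_space)
qed

definition trig_sum :: "(int \<Rightarrow> complex) \<Rightarrow> int set \<Rightarrow> real \<Rightarrow> complex" where
  "trig_sum a A x = (\<Sum>k\<in>A. a k * mode k x)"

lemma trig_sum_periodic [simp]: "trig_sum a A (x + 2 * pi) = trig_sum a A x"
  by (simp add: trig_sum_def)

lemma measurable_trig_sum [measurable]: "trig_sum a A \<in> borel_measurable borel"
  unfolding trig_sum_def by measurable

lemma norm_trig_sum_le: "norm (trig_sum a A x) \<le> (\<Sum>k\<in>A. norm (a k))"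
  unfolding trig_sum_def by (rule order.trans[OF norm_sum]) (simp add: norm_mult)

lemma integrable_trig_sum [simp]: "integrable torus (trig_sum a A)"
  by (rule integrable_torus_bounded[OF _ norm_trig_sum_le]) simp

lemma integrable_norm_power_trig_sum [simp]: "integrable torus (\<lambda>x. norm (trig_sum a A x) ^ n)"
  by (rule integrable_torus_bounded[of _ "(\<Sum>k\<in>A. norm (a k)) ^ n"])
    (auto intro!: power_mono norm_trig_sum_le)

lemma integral_trig_sum_mode:
  assumes "finite A"
  shows "(\<integral>x. trig_sum a A x * mode (- k) x \<partial>torus) = 2 * of_real pi * (if k \<in> A then a k else 0)"
proof -
  have "trig_sum a A x * mode (- k) x = (\<Sum>l\<in>A. a l * mode (l - k) x)" for x
    by (simp add: trig_sum_def sum_distrib_right mult.assoc mode_mult)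
  then have "(\<integral>x. trig_sum a A x * mode (- k) x \<partial>torus) = (\<Sum>l\<in>A. a l * integral\<^sup>L torus (mode (l - k)))"
    by (simp add: Bochner_Integration.integral_sum)
  also have "\<dots> = (\<Sum>l\<in>A. if k = l then 2 * of_real pi * a l else 0)"
    by (intro sum.cong) (auto simp: integral_mode)
  finally show ?thesis using assms by simp
qed

text \<open>
Expanding the square, only the diagonal terms survive, by orthogonality of the modes.
\<close>

lemma parseval_trig_sum:
  assumes "finite A"
  shows "(\<integral>x. (norm (trig_sum a A x))\<^sup>2 \<partial>torus) = 2 * pi * (\<Sum>k\<in>A. (norm (a k))\<^sup>2)"
proof -
  have cnj: "cnj (trig_sum a A x) = (\<Sum>k\<in>A. cnj (a k) * mode (- k) x)" for x
    by (simp add: trig_sum_def)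
  have "complex_of_real (\<integral>x. (norm (trig_sum a A x))\<^sup>2 \<partial>torus) =
      (\<integral>x. complex_of_real ((norm (trig_sum a A x))\<^sup>2) \<partial>torus)"
    by (rule integral_complex_of_real[symmetric])
  also have "\<dots> = (\<integral>x. (\<Sum>k\<in>A. cnj (a k) * (trig_sum a A x * mode (- k) x)) \<partial>torus)"
    by (simp only: complex_norm_square cnj sum_distrib_left mult.left_commute)
  also have "\<dots> = (\<Sum>k\<in>A. cnj (a k) * (2 * of_real pi * a k))"
    using assms by (subst Bochner_Integration.integral_sum)
      (auto intro!: sum.cong integrable_mult_right integrable_mult_bounded[of _ _ 1]
        simp: integral_trig_sum_mode)
  also have "\<dots> = complex_of_real (2 * pi * (\<Sum>k\<in>A. (norm (a k))\<^sup>2))"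
    by (simp add: sum_distrib_left complex_norm_square mult_ac del: of_real_power)
  finally show ?thesis by (simp only: of_real_eq_iff)
qed

text \<open>
  Squaring convolves the coefficients. All sums run over a fixed range of frequencies, with the
  coefficient sequence cut off outside \<open>{-N..N}\<close>, so that Parseval's identity applies.
\<close>

lemma trig_sum_square:
  "(trig_sum a {-int N..int N} x)\<^sup>2 =
   trig_sum (\<lambda>n. \<Sum>k\<in>{-int N..int N}. a k * (if n - k \<in> {-int N..int N} then a (n - k) else 0))
     {-2 * int N..2 * int N} x"
proof -
  let ?A = "{-int N..int N}" and ?B = "{-2 * int N..2 * int N}"
  have inner: "(\<Sum>l\<in>?A. a l * mode (k + l) x) =
      (\<Sum>n\<in>?B. (if n - k \<in> ?A then a (n - k) else 0) * mode n x)" if "k \<in> ?A" for k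
  proof -
    have "(\<Sum>l\<in>?A. a l * mode (k + l) x) = (\<Sum>n\<in>(+) k ` ?A. a (n - k) * mode n x)"
      by (subst sum.reindex) auto
    also have "\<dots> = (\<Sum>n\<in>?B. (if n - k \<in> ?A then a (n - k) else 0) * mode n x)"
    proof (intro sum.mono_neutral_cong_left ballI)
      show "(+) k ` ?A \<subseteq> ?B" using that by auto
      show "(if n - k \<in> ?A then a (n - k) else 0) * mode n x = 0" if "n \<in> ?B - (+) k ` ?A" for n
        using that by (auto simp: image_iff)
    qed auto
    finally show ?thesis .
  qed
  have "(trig_sum a ?A x)\<^sup>2 = (\<Sum>k\<in>?A. \<Sum>l\<in>?A. (a k * mode k x) * (a l * mode l x))"
    by (simp only: trig_sum_def power2_eq_square sum_product)
  also have "\<dots> = (\<Sum>k\<in>?A. \<Sum>l\<in>?A. a k * (a l * mode (k + l) x))"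
    by (intro sum.cong refl) (simp add: mult_ac flip: mode_mult)
  also have "\<dots> = (\<Sum>k\<in>?A. a k * (\<Sum>n\<in>?B. (if n - k \<in> ?A then a (n - k) else 0) * mode n x))"
    by (simp only: sum_distrib_left[symmetric] inner cong: sum.cong)
  also have "\<dots> = (\<Sum>n\<in>?B. \<Sum>k\<in>?A. a k * (if n - k \<in> ?A then a (n - k) else 0) * mode n x)"
    unfolding sum_distrib_left by (subst sum.swap) (simp only: mult.assoc)
  finally show ?thesis by (simp only: trig_sum_def sum_distrib_right)
qed

text \<open>
  The Hausdorff--Young inequality from \<open>\<ell>\<^sup>4\<^sup>/\<^sup>3\<close> to \<open>L\<^sup>4\<close>. As \<open>4\<close> is twice \<open>2\<close>, it needs no interpolation
  theory: \<open>\<parallel>S\<parallel>\<^sub>4\<^sup>4 = \<parallel>S\<^sup>2\<parallel>\<^sub>2\<^sup>2\<close> is given by Parseval's identity for the convolution square.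
\<close>

lemma integral_trig_sum_fourth_power_le:
  "(\<integral>x. norm (trig_sum a {-int N..int N} x) ^ 4 \<partial>torus) \<le>
    2 * pi * (\<Sum>k\<in>{-int N..int N}. root 3 (norm (a k)) ^ 4) ^ 3"
proof -
  let ?A = "{-int N..int N}" and ?B = "{-2 * int N..2 * int N}"
  define c where "c k = (if k \<in> ?A then root 3 (norm (a k)) else 0)" for k
  define d where "d n = (\<Sum>k\<in>?A. a k * (if n - k \<in> ?A then a (n - k) else 0))" for n
  have d_le: "norm (d n) \<le> (\<Sum>k\<in>?A. c k ^ 3 * c (n - k) ^ 3)" for n
    unfolding d_def by (rule order.trans[OF norm_sum]) (auto intro!: sum_mono simp: c_def norm_mult)
  have "(\<integral>x. norm (trig_sum a ?A x) ^ 4 \<partial>torus) = (\<integral>x. (norm ((trig_sum a ?A x)\<^sup>2))\<^sup>2 \<partial>torus)"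
    by (simp add: norm_power flip: power_mult)
  also have "\<dots> = (\<integral>x. (norm (trig_sum d ?B x))\<^sup>2 \<partial>torus)"
    by (simp only: trig_sum_square d_def[abs_def])
  also have "\<dots> = 2 * pi * (\<Sum>n\<in>?B. (norm (d n))\<^sup>2)"
    by (simp add: parseval_trig_sum)
  also have "\<dots> \<le> 2 * pi * (\<Sum>n\<in>?B. (\<Sum>k\<in>?A. c k ^ 3 * c (n - k) ^ 3)\<^sup>2)"
    by (intro mult_left_mono sum_mono power_mono d_le) auto
  also have "\<dots> \<le> 2 * pi * (\<Sum>k\<in>?A. c k ^ 4) ^ 3"
    by (intro mult_left_mono sum_convolution_le) (auto simp: c_def)
  also have "(\<Sum>k\<in>?A. c k ^ 4) = (\<Sum>k\<in>?A. root 3 (norm (a k)) ^ 4)"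
    by (simp add: c_def)
  finally show ?thesis .
qed

section \<open>Density of trigonometric polynomials\<close>

text \<open>
  Trigonometric polynomials as a set closed under sums: facts about them are then proved by
  induction from single modes, with no reference to a set of frequencies.
\<close>

inductive_set trig_poly :: "(real \<Rightarrow> complex) set" where
  monomial: "(\<lambda>x. c * mode k x) \<in> trig_poly"
| add: "p \<in> trig_poly \<Longrightarrow> q \<in> trig_poly \<Longrightarrow> (\<lambda>x. p x + q x) \<in> trig_poly"

lemma trig_poly_const: "(\<lambda>x. c) \<in> trig_poly"
  using trig_poly.monomial[of c 0] by simp

lemma trig_poly_mult:
  assumes "p \<in> trig_poly" "q \<in> trig_poly"
  shows "(\<lambda>x. p x * q x) \<in> trig_poly"
  using assms(1)
proof induction
  case (monomial c k)
  from assms(2) show ?case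
  proof induction
    case (monomial d l)
    have "(\<lambda>x. c * mode k x * (d * mode l x)) = (\<lambda>x. (c * d) * mode (k + l) x)"
      by (simp add: mult_ac flip: mode_mult)
    then show ?case by (simp only: trig_poly.monomial)
  next
    case (add p q)
    then show ?case using trig_poly.add by (simp add: distrib_left)
  qed
next
  case (add p q)
  then show ?case using trig_poly.add by (simp add: distrib_right)
qed

lemma trig_poly_real_polynomial:
  assumes "real_polynomial_function g"
  shows "(\<lambda>x. complex_of_real (g (cis x))) \<in> trig_poly"
  using assms
proof induction
  case (linear g)
  interpret bounded_linear g by fact
  define u where "u = complex_of_real (g 1)"
  define v where "v = complex_of_real (g \<i>)"
  have "complex_of_real (g (cis x)) =
      (u / 2 - \<i> * v / 2) * mode 1 x + (u / 2 + \<i> * v / 2) * mode (- 1) x" for x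
  proof -
    have "cis x = cos x *\<^sub>R 1 + sin x *\<^sub>R \<i>" by (simp add: complex_eq_iff)
    then have "g (cis x) = cos x * g 1 + sin x * g \<i>" by (simp add: add scaleR)
    then show ?thesis
      by (simp add: u_def v_def mode_def complex_eq_iff algebra_simps)
  qed
  then show ?case
    using trig_poly.add[OF trig_poly.monomial trig_poly.monomial] by simp
next
  case (const c)
  then show ?case by (rule trig_poly_const)
next
  case (add f g)
  then show ?case using trig_poly.add by simp
next
  case (mult f g)
  then show ?case using trig_poly_mult by simp
qed

text \<open>
  Stone--Weierstrass on the unit circle: a real polynomial in \<open>Re z\<close> and \<open>Im z\<close> becomes a
  trigonometric polynomial at \<open>z = cis x\<close>.
\<close>

lemma trig_poly_dense_circle:
  fixes \<Phi> :: "complex \<Rightarrow> complex"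
  assumes "continuous_on (sphere 0 1) \<Phi>" "\<epsilon> > 0"
  obtains p where "p \<in> trig_poly" "\<And>x. norm (\<Phi> (cis x) - p x) \<le> \<epsilon>"
proof -
  obtain g where g: "real_polynomial_function g"
      "\<And>z. z \<in> sphere 0 1 \<Longrightarrow> \<bar>Re (\<Phi> z) - g z\<bar> < \<epsilon> / 2"
    using assms by (auto intro: Stone_Weierstrass_real_polynomial_function
      [of "sphere 0 1" "\<lambda>z. Re (\<Phi> z)" "\<epsilon> / 2"] continuous_on_Re)
  obtain h where h: "real_polynomial_function h"
      "\<And>z. z \<in> sphere 0 1 \<Longrightarrow> \<bar>Im (\<Phi> z) - h z\<bar> < \<epsilon> / 2"
    using assms by (auto intro: Stone_Weierstrass_real_polynomial_function
      [of "sphere 0 1" "\<lambda>z. Im (\<Phi> z)" "\<epsilon> / 2"] continuous_on_Im)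
  define p where "p x = complex_of_real (g (cis x)) + \<i> * complex_of_real (h (cis x))" for x
  show ?thesis
  proof
    show "p \<in> trig_poly" unfolding p_def
      by (intro trig_poly.add trig_poly_mult trig_poly_const trig_poly_real_polynomial g h)
    show "norm (\<Phi> (cis x) - p x) \<le> \<epsilon>" for x
      using cmod_le[of "\<Phi> (cis x) - p x"] g(2)[of "cis x"] h(2)[of "cis x"]
      by (simp add: p_def)
  qed
qed

lemma periodic_int:
  fixes \<phi> :: "real \<Rightarrow> 'a"
  assumes per: "\<And>x. \<phi> (x + 2 * pi) = \<phi> x"
  shows "\<phi> (x + of_int n * (2 * pi)) = \<phi> x"
proof -
  have nat: "\<phi> (y + real m * (2 * pi)) = \<phi> y" for y m
  proof (induction m)
    case (Suc m)
    have "\<phi> (y + real (Suc m) * (2 * pi)) = \<phi> ((y + real m * (2 * pi)) + 2 * pi)"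
      by (simp add: algebra_simps)
    then show ?case using Suc per by simp
  qed simp
  show ?thesis
  proof (cases "n \<ge> 0")
    case True
    then show ?thesis using nat[of x "nat n"] by simp
  next
    case False
    then show ?thesis
      using nat[of "x + of_int n * (2 * pi)" "nat (- n)"] by (simp add: algebra_simps)
  qed
qed

lemma periodic_Arg_cis:
  fixes \<phi> :: "real \<Rightarrow> 'a"
  assumes "\<And>x. \<phi> (x + 2 * pi) = \<phi> x"
  shows "\<phi> (Arg (cis x)) = \<phi> x"
proof -
  have "cis (Arg (cis x)) = cis x" by (simp add: cis_Arg sgn_div_norm)
  then have "exp (\<i> * of_real (Arg (cis x))) = exp (\<i> * of_real x)"
    by (simp only: cis_conv_exp)
  then obtain n :: int where
    "\<i> * of_real (Arg (cis x)) = \<i> * of_real x + (of_int (2 * n) * pi) * \<i>"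
    unfolding exp_eq by blast
  from arg_cong[OF this, of Im] have "Arg (cis x) = x + of_int n * (2 * pi)" by simp
  then show ?thesis using periodic_int[of \<phi> x n] assms by simp
qed

text \<open>
  A continuous periodic function descends to the circle, although \<open>Arg\<close> itself jumps at
  \<open>- 1\<close>: preimages of closed sets are images of compact subsets of \<open>{-pi..pi}\<close> under \<open>cis\<close>.
\<close>

lemma continuous_on_Arg_periodic:
  fixes \<phi> :: "real \<Rightarrow> 'a::t2_space"
  assumes cont: "continuous_on UNIV \<phi>" and per: "\<And>x. \<phi> (x + 2 * pi) = \<phi> x"
  shows "continuous_on (sphere 0 1) (\<lambda>z. \<phi> (Arg z))"
  unfolding continuous_on_closed_invariant
proof (intro allI impI)
  fix B :: "'a set" assume "closed B"
  then have "closed (\<phi> -` B)" by (rule closed_vimage[OF _ cont])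
  then have "compact ({-pi..pi} \<inter> \<phi> -` B)" by (intro compact_Int_closed compact_Icc)
  then have "compact (cis ` ({-pi..pi} \<inter> \<phi> -` B))"
    by (intro compact_continuous_image continuous_intros)
  moreover have "cis ` ({-pi..pi} \<inter> \<phi> -` B) \<inter> sphere 0 1 = (\<lambda>z. \<phi> (Arg z)) -` B \<inter> sphere 0 1"
  proof (intro equalityI subsetI)
    fix z assume "z \<in> cis ` ({-pi..pi} \<inter> \<phi> -` B) \<inter> sphere 0 1"
    then show "z \<in> (\<lambda>z. \<phi> (Arg z)) -` B \<inter> sphere 0 1"
      using periodic_Arg_cis[of \<phi>] per by auto
  next
    fix z :: complex assume z: "z \<in> (\<lambda>z. \<phi> (Arg z)) -` B \<inter> sphere 0 1"
    then have "z \<noteq> 0" by auto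
    then have "cis (Arg z) = z" using z by (simp add: cis_Arg sgn_div_norm)
    moreover have "Arg z \<in> {-pi..pi}" using Arg_bounded[of z] by auto
    ultimately show "z \<in> cis ` ({-pi..pi} \<inter> \<phi> -` B) \<inter> sphere 0 1"
      using z by (auto intro!: image_eqI[of z cis "Arg z"])
  qed
  ultimately show "\<exists>A. closed A \<and> A \<inter> sphere 0 1 = (\<lambda>z. \<phi> (Arg z)) -` B \<inter> sphere 0 1"
    using compact_imp_closed by blast
qed

lemma nderiv_0 [simp]: "nderiv 0 \<phi> = \<phi>"
  by (simp add: nderiv_def)

lemma nderiv_Suc: "nderiv (Suc n) \<phi> x = vector_derivative (nderiv n \<phi>) (at x)"
  by (simp add: nderiv_def)

lemma nderiv_Suc_shift: "nderiv (Suc n) \<phi> = nderiv n (nderiv 1 \<phi>)"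
  by (simp add: nderiv_def funpow_Suc_right del: funpow.simps)

lemma per_test_has_derivative:
  assumes "\<phi> \<in> per_test"
  shows "(nderiv n \<phi> has_vector_derivative nderiv (Suc n) \<phi> x) (at x)"
  using assms by (simp add: nderiv_Suc per_test_def flip: vector_derivative_works)

lemma per_test_continuous:
  assumes "\<phi> \<in> per_test"
  shows "continuous_on A (nderiv n \<phi>)"
  using per_test_has_derivative[OF assms]
  by (meson continuous_at_imp_continuous_on has_vector_derivative_continuous)

lemma per_test_periodic: "\<phi> \<in> per_test \<Longrightarrow> \<phi> (x + 2 * pi) = \<phi> x"
  by (simp add: per_test_def)

lemma nderiv_add:
  assumes "\<phi> \<in> per_test" "\<psi> \<in> per_test"
  shows "nderiv n (\<lambda>x. \<phi> x + \<psi> x) = (\<lambda>x. nderiv n \<phi> x + nderiv n \<psi> x)"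
proof (induction n)
  case (Suc n)
  show ?case
    unfolding nderiv_Suc[of n "\<lambda>x. \<phi> x + \<psi> x"] fun_eq_iff Suc
    by (intro allI vector_derivative_at has_vector_derivative_add per_test_has_derivative assms)
qed simp

lemma nderiv_cmult:
  assumes "\<phi> \<in> per_test"
  shows "nderiv n (\<lambda>x. c * \<phi> x) = (\<lambda>x. c * nderiv n \<phi> x)"
proof (induction n)
  case (Suc n)
  show ?case
    unfolding nderiv_Suc[of n "\<lambda>x. c * \<phi> x"] fun_eq_iff Suc
    by (intro allI vector_derivative_at has_vector_derivative_mult_right per_test_has_derivative assms)
qed simp

lemma per_test_add:
  assumes "\<phi> \<in> per_test" "\<psi> \<in> per_test"
  shows "(\<lambda>x. \<phi> x + \<psi> x) \<in> per_test"
  using assms unfolding per_test_def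
  by (auto simp: nderiv_add[OF assms] intro: differentiable_add)

lemma per_test_cmult:
  assumes "\<phi> \<in> per_test"
  shows "(\<lambda>x. c * \<phi> x) \<in> per_test"
proof -
  have "(\<lambda>x. c * nderiv n \<phi> x) differentiable (at x)" for n x
    by (rule differentiableI_vector[OF has_vector_derivative_mult_right[OF per_test_has_derivative[OF assms]]])
  then show ?thesis
    using assms by (simp add: per_test_def nderiv_cmult[OF assms])
qed

lemma mode_per_test: "mode k \<in> per_test"
  using cis_per_test[of "- k"] by (simp add: mode_def[abs_def])

lemma trig_poly_per_test: "p \<in> trig_poly \<Longrightarrow> p \<in> per_test"
  by (induction rule: trig_poly.induct) (auto intro: per_test_add per_test_cmult mode_per_test)

lemma per_test_deriv:
  assumes "\<phi> \<in> per_test"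
  shows "nderiv 1 \<phi> \<in> per_test"
proof -
  have "nderiv 1 \<phi> (x + 2 * pi) = nderiv 1 \<phi> x" for x
  proof -
    have "((\<lambda>y. y + 2 * pi) has_vector_derivative 1) (at x)"
      by (auto intro!: derivative_eq_intros)
    then have "((\<phi> \<circ> (\<lambda>y. y + 2 * pi)) has_vector_derivative 1 *\<^sub>R nderiv 1 \<phi> (x + 2 * pi)) (at x)"
      using per_test_has_derivative[OF assms, of 0 "x + 2 * pi"] by (intro vector_diff_chain_at) auto
    moreover have "\<phi> \<circ> (\<lambda>y. y + 2 * pi) = \<phi>"
      using per_test_periodic[OF assms] by auto
    ultimately show ?thesis
      using per_test_has_derivative[OF assms, of 0 x] by (auto dest: vector_derivative_unique_at)
  qed
  then show ?thesis
    using assms unfolding per_test_def mem_Collect_eq nderiv_Suc_shift[symmetric] by blast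
qed

lemma trig_poly_primitive:
  assumes "q \<in> trig_poly"
  obtains c P where "P \<in> trig_poly" "\<And>x. (P has_vector_derivative q x - c) (at x)"
proof -
  from assms have "\<exists>c P. P \<in> trig_poly \<and> (\<forall>x. (P has_vector_derivative q x - c) (at x))"
  proof induction
    case (monomial c k)
    show ?case
    proof (cases "k = 0")
      case True
      then show ?thesis
        by (intro exI[of _ c] exI[of _ "\<lambda>x. 0"]) (auto intro: trig_poly_const)
    next
      case False
      have "(\<lambda>x. c / (\<i> * of_int k) * mode k x) \<in> trig_poly" by (rule trig_poly.monomial)
      moreover have "((\<lambda>x. c / (\<i> * of_int k) * mode k x) has_vector_derivative c * mode k x - 0) (at x)" for x
        using has_vector_derivative_mode[of "c / (\<i> * of_int k)" k x] False by simp
      ultimately show ?thesis by blast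
    qed
  next
    case (add p q)
    then obtain c P d Q where "P \<in> trig_poly" "\<And>x. (P has_vector_derivative p x - c) (at x)"
      "Q \<in> trig_poly" "\<And>x. (Q has_vector_derivative q x - d) (at x)" by blast
    then show ?case
      by (intro exI[of _ "c + d"] exI[of _ "\<lambda>x. P x + Q x"])
        (auto intro!: trig_poly.add derivative_eq_intros)
  qed
  then show ?thesis using that by blast
qed

lemma vector_derivative_bound_torus:
  fixes h :: "real \<Rightarrow> complex"
  assumes "\<And>x. (h has_vector_derivative h' x) (at x)"
    and "\<And>x. x \<in> {-pi..pi} \<Longrightarrow> norm (h' x) \<le> B" and "x \<in> {-pi..pi}" "y \<in> {-pi..pi}"
  shows "norm (h x - h y) \<le> B * \<bar>x - y\<bar>"
proof -
  have "norm (h x - h y) \<le> B * norm (x - y)"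
  proof (rule differentiable_bound[of "{-pi..pi}" h "\<lambda>x t. t *\<^sub>R h' x"])
    show "(h has_derivative (\<lambda>t. t *\<^sub>R h' x)) (at x within {-pi..pi})" for x
      using assms(1)[of x] by (simp add: has_vector_derivative_def has_derivative_at_withinI)
    show "onorm (\<lambda>t. t *\<^sub>R h' x) \<le> B" if "x \<in> {-pi..pi}" for x
      using assms(2)[OF that] by (intro onorm_le) (simp add: mult.commute[of B] mult_left_mono)
  qed (use assms in auto)
  then show ?thesis by simp
qed

text \<open>
  Density in the Frechet topology, by induction on the number of derivatives: approximate
  \<open>\<phi>'\<close>, remove the mean value of the approximation and integrate it. The mean value is small because
  that of \<open>\<phi>'\<close> vanishes by periodicity.
\<close>

lemma trig_poly_dense_per_test:
  assumes "\<phi> \<in> per_test" "\<epsilon> > 0"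
  shows "\<exists>p\<in>trig_poly. \<forall>j\<le>N. \<forall>x\<in>{-pi..pi}. norm (nderiv j \<phi> x - nderiv j p x) \<le> \<epsilon>"
  using assms
proof (induction N arbitrary: \<phi> \<epsilon>)
  case 0
  have per: "\<And>x. \<phi> (x + 2 * pi) = \<phi> x" by (rule per_test_periodic[OF 0(1)])
  have "continuous_on (sphere 0 1) (\<lambda>z. \<phi> (Arg z))"
    using per_test_continuous[OF 0(1), of UNIV 0] per by (intro continuous_on_Arg_periodic) auto
  then obtain p where "p \<in> trig_poly" "\<And>x. norm (\<phi> (Arg (cis x)) - p x) \<le> \<epsilon>"
    using trig_poly_dense_circle[OF _ 0(2)] by metis
  then show ?case using periodic_Arg_cis[of \<phi>, OF per] by auto
next
  case (Suc N)
  \<comment> \<open>Removing the mean doubles the error and integrating over a length at most \<open>pi < 4\<close> multiplies it by at most 4.\<close>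
  define \<delta> where "\<delta> = \<epsilon> / 8"
  have \<delta>: "\<delta> > 0" using Suc.prems by (simp add: \<delta>_def)
  obtain q where q: "q \<in> trig_poly"
      "\<And>j x. j \<le> N \<Longrightarrow> x \<in> {-pi..pi} \<Longrightarrow> norm (nderiv j (nderiv 1 \<phi>) x - nderiv j q x) \<le> \<delta>"
    using Suc.IH[OF per_test_deriv[OF Suc.prems(1)] \<delta>] by blast
  obtain c P where P: "P \<in> trig_poly" "\<And>x. (P has_vector_derivative q x - c) (at x)"
    using trig_poly_primitive[OF q(1)] by metis
  have \<phi>': "(\<phi> has_vector_derivative nderiv 1 \<phi> x) (at x)" for x
    using per_test_has_derivative[OF Suc.prems(1), of 0 x] by simp
  have q0: "norm (nderiv 1 \<phi> x - q x) \<le> \<delta>" if "x \<in> {-pi..pi}" for x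
    using q(2)[of 0 x] that by simp
  have c: "norm c \<le> \<delta>"
  proof -
    define h where "h x = P x + of_real x * c - \<phi> x" for x
    have h': "(h has_vector_derivative q x - nderiv 1 \<phi> x) (at x)" for x
      unfolding h_def by (auto intro!: derivative_eq_intros P \<phi>')
    have "norm (h pi - h (- pi)) \<le> \<delta> * \<bar>pi - (- pi)\<bar>"
      using q0 by (intro vector_derivative_bound_torus[OF h']) (auto simp: norm_minus_commute)
    also have "h pi - h (- pi) = of_real (2 * pi) * c"
      using per_test_periodic[OF Suc.prems(1), of "- pi"]
        per_test_periodic[OF trig_poly_per_test[OF P(1)], of "- pi"]
      by (simp add: h_def algebra_simps)
    finally show ?thesis by (simp add: norm_mult)
  qed
  define R where "R x = P x + (\<phi> 0 - P 0)" for x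
  have R: "R \<in> trig_poly" unfolding R_def by (intro trig_poly.add P trig_poly_const)
  have R': "(R has_vector_derivative q x - c) (at x)" for x
    unfolding R_def by (auto intro!: derivative_eq_intros P)
  have nderiv_R: "nderiv 1 R = (\<lambda>x. q x + - c * mode 0 x)"
    using vector_derivative_at[OF R'] by (simp add: fun_eq_iff nderiv_def)
  have "norm (nderiv j \<phi> x - nderiv j R x) \<le> \<epsilon>" if j: "j \<le> Suc N" and x: "x \<in> {-pi..pi}" for j x
  proof (cases j)
    case 0
    have "norm ((\<phi> x - R x) - (\<phi> 0 - R 0)) \<le> (2 * \<delta>) * \<bar>x - 0\<bar>"
    proof (rule vector_derivative_bound_torus[where h = "\<lambda>x. \<phi> x - R x"])
      show "((\<lambda>x. \<phi> x - R x) has_vector_derivative nderiv 1 \<phi> x - (q x - c)) (at x)" for x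
        by (intro has_vector_derivative_diff \<phi>' R')
      show "norm (nderiv 1 \<phi> y - (q y - c)) \<le> 2 * \<delta>" if "y \<in> {-pi..pi}" for y
        using norm_triangle_ineq[of "nderiv 1 \<phi> y - q y" c] q0[OF that] c by (simp add: algebra_simps)
    qed (use x in auto)
    also have "\<dots> \<le> (2 * \<delta>) * 4"
      using x pi_less_4 \<delta> by (intro mult_left_mono) auto
    finally show ?thesis using 0 by (simp add: R_def \<delta>_def)
  next
    case (Suc i)
    have "nderiv j \<phi> x - nderiv j R x =
        (nderiv i (nderiv 1 \<phi>) x - nderiv i q x) + c * nderiv i (mode 0) x"
      unfolding Suc nderiv_Suc_shift nderiv_R
      using nderiv_add[OF trig_poly_per_test[OF q(1)] per_test_cmult[OF mode_per_test], of i "- c" 0]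
        nderiv_cmult[OF mode_per_test, of i "- c" 0] by simp
    moreover have "norm (nderiv i (mode 0) x) \<le> 1"
      using nderiv_cis[of i 0] by (simp add: mode_def[abs_def] norm_power power_0_left)
    then have "norm (c * nderiv i (mode 0) x) \<le> norm c"
      using mult_left_mono[of "norm (nderiv i (mode 0) x)" 1 "norm c"] by (simp add: norm_mult)
    moreover have "norm (nderiv i (nderiv 1 \<phi>) x - nderiv i q x) \<le> \<delta>"
      using q(2) j x Suc by simp
    ultimately have "norm (nderiv j \<phi> x - nderiv j R x) \<le> \<delta> + norm c"
      by (metis norm_triangle_mono)
    then show ?thesis using c \<delta> by (simp add: \<delta>_def)
  qed
  then show ?case using R by blast
qed

section \<open>Periodic distributions and their Fourier coefficients\<close>

lemma per_distr_continuous: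
  assumes "u \<in> per_distr"
  obtains K N where "0 \<le> K" "\<And>\<phi> \<epsilon>. \<phi> \<in> per_test \<Longrightarrow>
    (\<And>j x. j \<le> N \<Longrightarrow> x \<in> {-pi..pi} \<Longrightarrow> norm (nderiv j \<phi> x) \<le> \<epsilon>) \<Longrightarrow> norm (u \<phi>) \<le> K * \<epsilon>"
proof -
  obtain C N where CN: "\<And>\<phi>. \<phi> \<in> per_test \<Longrightarrow>
      norm (u \<phi>) \<le> C * (\<Sum>j\<le>N. SUP x\<in>{-pi..pi}. norm (nderiv j \<phi> x))"
    using assms unfolding per_distr_def by blast
  show ?thesis
  proof
    show "0 \<le> \<bar>C\<bar> * real (Suc N)" by simp
    fix \<phi> and \<epsilon> :: real
    assume \<phi>: "\<phi> \<in> per_test"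
      and le: "\<And>j x. j \<le> N \<Longrightarrow> x \<in> {-pi..pi} \<Longrightarrow> norm (nderiv j \<phi> x) \<le> \<epsilon>"
    let ?S = "\<lambda>j. SUP x\<in>{-pi..pi}. norm (nderiv j \<phi> x)"
    have S: "0 \<le> ?S j \<and> ?S j \<le> \<epsilon>" if "j \<le> N" for j
    proof
      show "?S j \<le> \<epsilon>" using le that by (intro cSUP_least) auto
      show "0 \<le> ?S j"
        by (rule cSUP_upper2[of _ _ 0]) (use le that in \<open>auto intro!: bdd_aboveI2[of _ _ \<epsilon>]\<close>)
    qed
    have "norm (u \<phi>) \<le> C * (\<Sum>j\<le>N. ?S j)" by (rule CN[OF \<phi>])
    also have "\<dots> \<le> \<bar>C\<bar> * (\<Sum>j\<le>N. ?S j)"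
      using S by (intro mult_right_mono sum_nonneg) auto
    also have "\<dots> \<le> \<bar>C\<bar> * (\<Sum>j\<le>N. \<epsilon>)"
      using S by (intro mult_left_mono sum_mono) auto
    finally show "norm (u \<phi>) \<le> \<bar>C\<bar> * real (Suc N) * \<epsilon>" by simp
  qed
qed

lemma per_distr_add: "u \<in> per_distr \<Longrightarrow> \<phi> \<in> per_test \<Longrightarrow> \<psi> \<in> per_test \<Longrightarrow>
    u (\<lambda>x. \<phi> x + \<psi> x) = u \<phi> + u \<psi>"
  and per_distr_cmult: "u \<in> per_distr \<Longrightarrow> \<phi> \<in> per_test \<Longrightarrow> u (\<lambda>x. c * \<phi> x) = c * u \<phi>"
  by (simp_all add: per_distr_def)

lemma fourier_coeff_mode: "fourier_coeff u k = u (mode (- k)) / (2 * of_real pi)"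
  by (simp add: fourier_coeff_def mode_def[abs_def])

lemma per_distr_approx:
  assumes "u \<in> per_distr" "\<phi> \<in> per_test"
  obtains K N where "0 \<le> K" "\<And>p \<epsilon>. p \<in> trig_poly \<Longrightarrow>
    (\<And>j x. j \<le> N \<Longrightarrow> x \<in> {-pi..pi} \<Longrightarrow> norm (nderiv j \<phi> x - nderiv j p x) \<le> \<epsilon>) \<Longrightarrow>
    norm (u \<phi> - u p) \<le> K * \<epsilon>"
proof -
  obtain K N where K: "0 \<le> K" "\<And>\<phi> \<epsilon>. \<phi> \<in> per_test \<Longrightarrow>
      (\<And>j x. j \<le> N \<Longrightarrow> x \<in> {-pi..pi} \<Longrightarrow> norm (nderiv j \<phi> x) \<le> \<epsilon>) \<Longrightarrow> norm (u \<phi>) \<le> K * \<epsilon>"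
    using per_distr_continuous[OF assms(1)] by metis
  show ?thesis
  proof
    fix p \<epsilon> assume p: "p \<in> trig_poly"
      and le: "\<And>j x. j \<le> N \<Longrightarrow> x \<in> {-pi..pi} \<Longrightarrow> norm (nderiv j \<phi> x - nderiv j p x) \<le> \<epsilon>"
    note pt = trig_poly_per_test[OF p]
    have "u (\<lambda>x. \<phi> x + (- 1) * p x) = u \<phi> - u p"
      using per_distr_add[OF assms(1,2) per_test_cmult[OF pt], of "- 1"]
        per_distr_cmult[OF assms(1) pt, of "- 1"] by simp
    moreover have "norm (u (\<lambda>x. \<phi> x + (- 1) * p x)) \<le> K * \<epsilon>"
    proof (rule K(2))
      show "(\<lambda>x. \<phi> x + - 1 * p x) \<in> per_test"
        by (intro per_test_add per_test_cmult assms pt)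
      show "norm (nderiv j (\<lambda>x. \<phi> x + - 1 * p x) x) \<le> \<epsilon>" if "j \<le> N" "x \<in> {-pi..pi}" for j x
        using nderiv_add[OF assms(2) per_test_cmult[OF pt], of j "- 1"] nderiv_cmult[OF pt, of j "- 1"]
          le[OF that] by simp
    qed
    ultimately show "norm (u \<phi> - u p) \<le> K * \<epsilon>" by simp
  qed (rule K(1))
qed

text \<open>
  Two distributions with the same coefficients agree on modes, hence on trigonometric
  polynomials, hence on all test functions by density and continuity.
\<close>

theorem per_distr_eqI:
  assumes u: "u \<in> per_distr" and v: "v \<in> per_distr"
    and eq: "\<And>k. fourier_coeff u k = fourier_coeff v k"
  shows "u = v"
proof
  fix \<phi>
  have mode: "u (mode k) = v (mode k)" for k
    using eq[of "- k"] by (simp add: fourier_coeff_mode)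
  have poly: "u p = v p" if "p \<in> trig_poly" for p
    using that
    by induction (simp_all add: per_distr_add per_distr_cmult u v mode mode_per_test trig_poly_per_test)
  show "u \<phi> = v \<phi>"
  proof (cases "\<phi> \<in> per_test")
    case False
    then show ?thesis using u v by (simp add: per_distr_def)
  next
    case True
    obtain K N where K: "0 \<le> K" "\<And>p \<epsilon>. p \<in> trig_poly \<Longrightarrow>
      (\<And>j x. j \<le> N \<Longrightarrow> x \<in> {-pi..pi} \<Longrightarrow> norm (nderiv j \<phi> x - nderiv j p x) \<le> \<epsilon>) \<Longrightarrow>
      norm (u \<phi> - u p) \<le> K * \<epsilon>" using per_distr_approx[OF u True] by metis
    obtain L M where L: "0 \<le> L" "\<And>p \<epsilon>. p \<in> trig_poly \<Longrightarrow>
      (\<And>j x. j \<le> M \<Longrightarrow> x \<in> {-pi..pi} \<Longrightarrow> norm (nderiv j \<phi> x - nderiv j p x) \<le> \<epsilon>) \<Longrightarrow>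
      norm (v \<phi> - v p) \<le> L * \<epsilon>" using per_distr_approx[OF v True] by metis
    have "norm (u \<phi> - v \<phi>) \<le> 0 + e" if "e > 0" for e
    proof -
      define \<epsilon> where "\<epsilon> = e / (K + L + 1)"
      have \<epsilon>: "\<epsilon> > 0" using that K(1) L(1) by (simp add: \<epsilon>_def)
      obtain p where p: "p \<in> trig_poly"
        "\<And>j x. j \<le> max N M \<Longrightarrow> x \<in> {-pi..pi} \<Longrightarrow> norm (nderiv j \<phi> x - nderiv j p x) \<le> \<epsilon>"
        using trig_poly_dense_per_test[OF True \<epsilon>] by blast
      have "norm (u \<phi> - v \<phi>) = norm ((u \<phi> - u p) - (v \<phi> - v p))"
        using poly[OF p(1)] by simp
      also have "\<dots> \<le> norm (u \<phi> - u p) + norm (v \<phi> - v p)"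
        by (rule norm_triangle_ineq4)
      also have "\<dots> \<le> K * \<epsilon> + L * \<epsilon>"
        by (intro add_mono K(2) L(2) p) auto
      also have "\<dots> \<le> (K + L + 1) * \<epsilon>" using \<epsilon> by (simp add: algebra_simps)
      also have "\<dots> = e" using K(1) L(1) by (simp add: \<epsilon>_def)
      finally show ?thesis by simp
    qed
    then have "norm (u \<phi> - v \<phi>) \<le> 0" by (rule field_le_epsilon)
    then show ?thesis by simp
  qed
qed

text \<open>The value 0 off the test functions is the one that makes \<^term>\<open>distr_of g\<close> an element of \<^const>\<open>per_distr\<close>.\<close>

definition distr_of :: "(real \<Rightarrow> complex) \<Rightarrow> (real \<Rightarrow> complex) \<Rightarrow> complex" where
  "distr_of g \<phi> = (if \<phi> \<in> per_test then \<integral>x. g x * \<phi> x \<partial>torus else 0)"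

lemma per_test_measurable: "\<phi> \<in> per_test \<Longrightarrow> \<phi> \<in> borel_measurable borel"
  using per_test_continuous[of \<phi> UNIV 0] by (intro borel_measurable_continuous_onI) simp

lemma per_test_le_SUP:
  assumes "\<phi> \<in> per_test" "x \<in> {-pi..pi}"
  shows "norm (\<phi> x) \<le> (SUP x\<in>{-pi..pi}. norm (\<phi> x))"
proof (rule cSUP_upper[OF assms(2)])
  have "compact ((\<lambda>x. norm (\<phi> x)) ` {-pi..pi})"
    using per_test_continuous[OF assms(1), of _ 0]
    by (intro compact_continuous_image continuous_intros) auto
  then show "bdd_above ((\<lambda>x. norm (\<phi> x)) ` {-pi..pi})"
    by (intro bounded_imp_bdd_above compact_imp_bounded)
qed

lemma integrable_mult_per_test:
  "integrable torus g \<Longrightarrow> \<phi> \<in> per_test \<Longrightarrow> integrable torus (\<lambda>x. g x * \<phi> x)"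
  by (rule integrable_mult_bounded[OF _ per_test_measurable per_test_le_SUP])

lemma distr_of_per_distr:
  assumes g: "integrable torus g"
  shows "distr_of g \<in> per_distr"
proof -
  have "norm (distr_of g \<phi>) \<le> (\<integral>x. norm (g x) \<partial>torus) * (\<Sum>j\<le>0. SUP x\<in>{-pi..pi}. norm (nderiv j \<phi> x))"
    if \<phi>: "\<phi> \<in> per_test" for \<phi>
  proof -
    define S where "S = (SUP x\<in>{-pi..pi}. norm (\<phi> x))"
    have "norm (distr_of g \<phi>) \<le> (\<integral>x. norm (g x * \<phi> x) \<partial>torus)"
      using \<phi> by (simp add: distr_of_def)
    also have "\<dots> \<le> (\<integral>x. norm (g x) * S \<partial>torus)"
      using g \<phi> per_test_le_SUP[OF \<phi>] unfolding S_def
      by (intro integral_mono integrable_norm integrable_mult_per_test integrable_mult_left)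
        (auto simp: norm_mult intro!: mult_left_mono)
    finally show ?thesis by (simp add: S_def)
  qed
  then show ?thesis
    using g unfolding per_distr_def
    by (auto simp: distr_of_def per_test_add per_test_cmult distrib_left
        integrable_mult_per_test mult.left_commute[of _ c for c]
        intro!: exI[of _ "\<integral>x. norm (g x) \<partial>torus"] exI[of _ "0::nat"])
qed

lemma fourier_coeff_distr_of:
  "fourier_coeff (distr_of g) k = (\<integral>x. g x * mode (- k) x \<partial>torus) / (2 * of_real pi)"
  by (simp add: fourier_coeff_mode distr_of_def mode_per_test)

section \<open>Integrable functions with vanishing Fourier coefficients\<close>

lemma continuous_on_cis_id: "continuous_on A cis"
  by (intro continuous_intros)

text \<open>
  Modes span a dense subspace of the continuous functions on the circle, and an integrable \<open>h\<close> is
  continuous for uniform convergence. Testing \<open>h\<close> against such functions is the first stage on the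
  way to testing it against indicators of sets.
\<close>

lemma integral_mult_circle_continuous_eq_0:
  assumes h: "integrable torus h" and zero: "\<And>k. (\<integral>x. h x * mode k x \<partial>torus) = 0"
    and \<Phi>: "continuous_on (sphere 0 1) \<Phi>"
  shows "(\<integral>x. h x * \<Phi> (cis x) \<partial>torus) = 0"
proof -
  have mult: "integrable torus (\<lambda>x. h x * p x)" if "p \<in> trig_poly" for p
    by (intro integrable_mult_per_test h trig_poly_per_test that)
  have poly: "(\<integral>x. h x * p x \<partial>torus) = 0" if "p \<in> trig_poly" for p
    using that
  proof induction
    case (monomial c k)
    then show ?case using zero[of k] by (simp add: mult.left_commute)
  next
    case (add p q)
    then show ?case by (simp add: distrib_left mult)
  qed
  have cont: "continuous_on UNIV (\<lambda>x. \<Phi> (cis x))"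
    by (rule continuous_on_compose2[OF \<Phi> continuous_on_cis_id]) auto
  have "compact (\<Phi> ` sphere 0 1)" by (intro compact_continuous_image \<Phi>) simp
  from compact_imp_bounded[OF this] obtain B where "\<forall>w\<in>\<Phi> ` sphere 0 1. norm w \<le> B"
    unfolding bounded_iff by (elim exE)
  then have B: "norm (\<Phi> z) \<le> B" if "z \<in> sphere 0 1" for z
    using that by blast
  have int\<Phi>: "integrable torus (\<lambda>x. h x * \<Phi> (cis x))"
    by (rule integrable_mult_bounded[OF h borel_measurable_continuous_onI[OF cont], of B]) (simp add: B)
  define I where "I = (\<integral>x. norm (h x) \<partial>torus)"
  have I0: "0 \<le> I" by (simp add: I_def)
  have "norm (\<integral>x. h x * \<Phi> (cis x) \<partial>torus) \<le> 0 + e" if "e > 0" for e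
  proof -
    define \<epsilon> where "\<epsilon> = e / (I + 1)"
    have \<epsilon>: "\<epsilon> > 0" using that I0 by (simp add: \<epsilon>_def)
    obtain p where p: "p \<in> trig_poly" "\<And>x. norm (\<Phi> (cis x) - p x) \<le> \<epsilon>"
      using trig_poly_dense_circle[OF \<Phi> \<epsilon>] by metis
    have "(\<integral>x. h x * \<Phi> (cis x) \<partial>torus) = (\<integral>x. h x * \<Phi> (cis x) - h x * p x \<partial>torus)"
      using poly[OF p(1)] by (simp add: int\<Phi> mult[OF p(1)])
    also have "norm \<dots> \<le> (\<integral>x. norm (h x * \<Phi> (cis x) - h x * p x) \<partial>torus)"
      by (rule integral_norm_bound)
    also have "\<dots> \<le> (\<integral>x. norm (h x) * \<epsilon> \<partial>torus)"
    proof (rule integral_mono)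
      show "norm (h x * \<Phi> (cis x) - h x * p x) \<le> norm (h x) * \<epsilon>" for x
        using p(2)[of x] by (simp add: norm_mult mult_left_mono flip: right_diff_distrib)
    qed (use h int\<Phi> mult[OF p(1)] in auto)
    also have "\<dots> = I * \<epsilon>" by (simp add: I_def)
    also have "\<dots> \<le> (I + 1) * \<epsilon>" using \<epsilon> by (intro mult_right_mono) auto
    also have "\<dots> = e" using I0 by (simp add: \<epsilon>_def)
    finally show ?thesis by simp
  qed
  then have "norm (\<integral>x. h x * \<Phi> (cis x) \<partial>torus) \<le> 0" by (rule field_le_epsilon)
  then show ?thesis by simp
qed

lemma integral_mult_circle_indicator_eq_0:
  assumes h: "integrable torus h" and zero: "\<And>k. (\<integral>x. h x * mode k x \<partial>torus) = 0"
    and K: "closed K" "K \<noteq> {}"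
  shows "(\<integral>x. h x * indicator K (cis x) \<partial>torus) = 0"
proof -
  \<comment> \<open>Continuous functions decreasing to the indicator of the closed set \<open>K\<close>.\<close>
  define \<psi> where "\<psi> n z = complex_of_real (max 0 (1 - real n * infdist z K))" for n z
  have cont: "continuous_on A (\<psi> n)" for n A
    unfolding \<psi>_def by (intro continuous_intros)
  have meas: "(\<lambda>x. \<psi> n (cis x)) \<in> borel_measurable borel" for n
    by (intro borel_measurable_continuous_onI continuous_on_compose2[OF cont continuous_on_cis_id]) auto
  have bound: "norm (\<psi> n z) \<le> 1" for n z
    using infdist_nonneg[of z K] by (simp add: \<psi>_def)
  have lim: "(\<lambda>n. \<psi> n z) \<longlonglongrightarrow> indicator K z" for z
  proof (cases "z \<in> K")
    case True
    then show ?thesis by (simp add: \<psi>_def)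
  next
    case False
    then have pos: "infdist z K > 0"
      using K by (simp add: infdist_pos_not_in_closed)
    obtain m :: nat where m: "real m * infdist z K > 1"
      using reals_Archimedean3[OF pos] by blast
    have "\<psi> n z = 0" if "n \<ge> m" for n
    proof -
      have "real m * infdist z K \<le> real n * infdist z K"
        using that pos by (intro mult_right_mono) auto
      then show ?thesis using m by (simp add: \<psi>_def)
    qed
    then have "\<forall>\<^sub>F n in sequentially. \<psi> n z = 0"
      using eventually_sequentially by blast
    then show ?thesis using False by (simp add: tendsto_eventually)
  qed
  have "(\<lambda>n. \<integral>x. h x * \<psi> n (cis x) \<partial>torus) \<longlonglongrightarrow> (\<integral>x. h x * indicator K (cis x) \<partial>torus)"
  proof (rule integral_dominated_convergence[where w = "\<lambda>x. norm (h x)"])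
    have hm: "h \<in> borel_measurable torus" using h by (rule borel_measurable_integrable)
    show hn: "(\<lambda>x. h x * \<psi> n (cis x)) \<in> borel_measurable torus" for n
      by (rule borel_measurable_times[OF hm measurable_torus[OF meas]])
    show hl: "AE x in torus. (\<lambda>n. h x * \<psi> n (cis x)) \<longlonglongrightarrow> h x * indicator K (cis x)"
      by (intro AE_I2 tendsto_intros lim)
    have "(\<lambda>x. indicator K (cis x) :: complex) \<in> borel_measurable borel"
      by (rule borel_measurable_LIMSEQ_metric[OF meas]) (rule lim)
    then show "(\<lambda>x. h x * indicator K (cis x)) \<in> borel_measurable torus"
      by (intro borel_measurable_times[OF hm] measurable_torus)
    show "AE x in torus. norm (h x * \<psi> n (cis x)) \<le> norm (h x)" for n
      using bound by (intro AE_I2) (simp add: norm_mult mult_left_le)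
  qed (use h in simp)
  moreover have "(\<integral>x. h x * \<psi> n (cis x) \<partial>torus) = 0" for n
    by (rule integral_mult_circle_continuous_eq_0[OF h zero cont])
  ultimately show ?thesis by (simp add: LIMSEQ_const_iff)
qed

lemma cis_minus_pi: "cis (- pi) = cis pi"
  by (simp add: complex_eq_iff)

lemma AE_torus_iff: "(AE x in torus. P x) \<longleftrightarrow> (AE x in lborel. x \<in> {-pi..pi} \<longrightarrow> P x)"
  unfolding torus_def by (rule AE_restrict_space_iff) simp

lemma AE_torus_ne_pi: "AE x in torus. x \<noteq> pi"
  unfolding AE_torus_iff using AE_lborel_singleton[of pi] by eventually_elim simp

text \<open>
  For \<open>-pi \<le> a < pi\<close>, the half-line \<open>{..a}\<close> meets the torus in an arc that is compact in the
  circle. The arc contains the point \<open>- 1\<close>, which also belongs to \<open>x = pi\<close>; this single value of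
  \<open>x\<close> is a null set.
\<close>

lemma integral_atMost_eq_0:
  assumes h: "integrable torus h" and zero: "\<And>k. (\<integral>x. h x * mode k x \<partial>torus) = 0"
  shows "(\<integral>x. indicator {..a} x *\<^sub>R h x \<partial>torus) = 0"
proof -
  consider "a \<ge> pi" | "a < - pi" | "- pi \<le> a" "a < pi" by linarith
  then show ?thesis
  proof cases
    case 1
    then have "(\<integral>x. indicator {..a} x *\<^sub>R h x \<partial>torus) = (\<integral>x. h x * mode 0 x \<partial>torus)"
      by (intro Bochner_Integration.integral_cong refl) (auto simp: indicator_def)
    then show ?thesis by (simp only: zero)
  next
    case 2
    then have "(\<integral>x. indicator {..a} x *\<^sub>R h x \<partial>torus) = (\<integral>x. 0 \<partial>torus)"
      by (intro Bochner_Integration.integral_cong refl) (auto simp: indicator_def)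
    then show ?thesis by simp
  next
    case 3
    define K where "K = cis ` {-pi..a}"
    have "compact K" unfolding K_def
      by (intro compact_continuous_image continuous_intros compact_Icc)
    then have K: "closed K" "K \<noteq> {}"
      using 3 by (auto simp: compact_imp_closed K_def)
    have iff: "cis x \<in> K \<longleftrightarrow> x \<le> a" if x: "x \<in> {-pi..pi}" "x \<noteq> pi" for x
    proof
      assume "x \<le> a"
      then show "cis x \<in> K" using x by (auto simp: K_def)
    next
      assume "cis x \<in> K"
      then obtain y where y: "y \<in> {-pi..a}" "cis x = cis y" by (auto simp: K_def)
      show "x \<le> a"
      proof (cases "x = - pi")
        case False
        then have Ax: "Arg (cis x) = x" using x by (intro Arg_cis) auto
        show ?thesis
        proof (cases "y = - pi")
          case True
          then have "Arg (cis y) = pi"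
            using Arg_cis[of pi] \<open>y = - pi\<close> by (simp add: cis_minus_pi)
          then show ?thesis using Ax y x by simp
        next
          case False
          then have "Arg (cis y) = y" using y 3 by (intro Arg_cis) auto
          then show ?thesis using Ax y by simp
        qed
      qed (use 3 in simp)
    qed
    have "(\<integral>x. indicator {..a} x *\<^sub>R h x \<partial>torus) = (\<integral>x. h x * indicator K (cis x) \<partial>torus)"
    proof (rule integral_cong_AE)
      show "AE x in torus. indicator {..a} x *\<^sub>R h x = h x * indicator K (cis x)"
        using AE_torus_ne_pi AE_space
        by eventually_elim (auto simp: iff indicator_def)
      have hm: "h \<in> borel_measurable torus" using h by (rule borel_measurable_integrable)
      show "(\<lambda>x. indicator {..a} x *\<^sub>R h x) \<in> borel_measurable torus"
        by (intro borel_measurable_scaleR hm measurable_torus) simp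
      have "(\<lambda>x. indicator K (cis x) :: complex) \<in> borel_measurable borel"
        using K(1) by (intro measurable_compose[OF borel_measurable_continuous_onI[OF continuous_on_cis_id]]
          borel_measurable_indicator) simp
      then show "(\<lambda>x. h x * indicator K (cis x)) \<in> borel_measurable torus"
        by (intro borel_measurable_times[OF hm] measurable_torus)
    qed
    then show ?thesis
      by (simp only: integral_mult_circle_indicator_eq_0[OF h zero K])
  qed
qed

text \<open>
  The half-lines \<open>{..a}\<close> form a generator of the Borel sets that is stable under intersection, so
  the integral over every Borel set vanishes.
\<close>

theorem AE_eq_0_if_fourier_coeffs_0:
  assumes h: "integrable torus h" and zero: "\<And>k. (\<integral>x. h x * mode k x \<partial>torus) = 0"
  shows "AE x in torus. h x = 0"
proof -
  define H where "H x = indicator {-pi..pi} x *\<^sub>R h x" for x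
  have H: "integrable lborel H"
    using h unfolding H_def by (simp add: torus_def integrable_restrict_space)
  have eq: "(LINT x:A|lborel. H x) = (\<integral>x. indicator A x *\<^sub>R h x \<partial>torus)" for A
    unfolding H_def torus_def set_lebesgue_integral_def
    by (simp add: integral_restrict_space mult.commute)
  have H_set: "set_integrable lborel A H" if "A \<in> sets borel" for A
    using H that unfolding set_integrable_def by (intro integrable_mult_indicator) auto
  have "(LINT x:A|lborel. H x) = 0" if "A \<in> sets borel" for A
  proof -
    let ?G = "range (\<lambda>a::real. {..a})"
    have gen: "sets borel = sigma_sets UNIV ?G"
      by (simp add: borel_eq_atMost)
    have "Int_stable ?G"
      by (auto simp: Int_stable_def Int_atMost)
    moreover have "?G \<subseteq> Pow UNIV" by simp
    moreover have "A \<in> sigma_sets UNIV ?G" using that gen by simp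
    ultimately show ?thesis
    proof (induction rule: sigma_sets_induct_disjoint)
      case (basic A)
      then show ?case using integral_atMost_eq_0[OF h zero] by (auto simp: eq)
    next
      case empty
      then show ?case by (simp add: set_lebesgue_integral_def)
    next
      case (compl A)
      then have A: "A \<in> sets borel" using gen by simp
      have "(LINT x:UNIV - A \<union> A|lborel. H x) = (LINT x:UNIV - A|lborel. H x) + (LINT x:A|lborel. H x)"
        using A by (intro set_integral_Un H_set) auto
      moreover have "(LINT x:UNIV|lborel. H x) = 0"
        using zero[of 0] by (simp add: eq)
      ultimately show ?case using compl by simp
    next
      case (union A)
      then have A: "A i \<in> sets borel" for i using gen by auto
      have "(LINT x:(\<Union>i. A i)|lborel. H x) = (\<Sum>i. (LINT x:A i|lborel. H x))"
        using A union(1) by (intro lebesgue_integral_countable_add H_set)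
          (auto simp: disjoint_family_on_def)
      then show ?case using union by simp
    qed
  qed
  then have "AE x in lborel. H x = 0"
    using H by (intro sigma_finite_measure.density_zero[OF sigma_finite_lborel]) auto
  then show ?thesis
    unfolding AE_torus_iff by eventually_elim (auto simp: H_def)
qed

section \<open>The Riesz--Fischer theorem and Fatou's lemma\<close>

lemma AE_summable_norm:
  fixes f :: "nat \<Rightarrow> 'a \<Rightarrow> 'b::{banach, second_countable_topology}"
  assumes int: "\<And>i. integrable M (f i)" and sums: "summable (\<lambda>i. \<integral>x. norm (f i x) \<partial>M)"
  shows "AE x in M. summable (\<lambda>i. norm (f i x))"
proof -
  have [measurable]: "f i \<in> borel_measurable M" for i
    using int by (rule borel_measurable_integrable)
  have "(\<integral>\<^sup>+x. (\<Sum>i. ennreal (norm (f i x))) \<partial>M) = (\<Sum>i. \<integral>\<^sup>+x. ennreal (norm (f i x)) \<partial>M)"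
    by (rule nn_integral_suminf) measurable
  also have "\<dots> = (\<Sum>i. ennreal (\<integral>x. norm (f i x) \<partial>M))"
    by (simp add: nn_integral_eq_integral int)
  also have "\<dots> = ennreal (\<Sum>i. \<integral>x. norm (f i x) \<partial>M)"
    by (intro suminf_ennreal2 sums) simp
  finally have "(\<integral>\<^sup>+x. (\<Sum>i. ennreal (norm (f i x))) \<partial>M) \<noteq> \<infinity>" by simp
  then have "AE x in M. (\<Sum>i. ennreal (norm (f i x))) \<noteq> \<infinity>"
    by (intro nn_integral_PInf_AE) measurable
  then show ?thesis
    by eventually_elim (auto intro: summable_suminf_not_top)
qed

text \<open>
  Cauchy--Schwarz on a space of measure \<open>2 pi\<close>, in the form \<open>2 \<bar>S\<bar> \<le> t + \<bar>S\<bar>\<^sup>2 / t\<close>.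
\<close>

lemma integral_norm_trig_sum_le:
  assumes "finite A" "t > 0" "(\<Sum>k\<in>A. (norm (a k))\<^sup>2) \<le> t\<^sup>2"
  shows "(\<integral>x. norm (trig_sum a A x) \<partial>torus) \<le> 2 * pi * t"
proof -
  have "(\<integral>x. norm (trig_sum a A x) \<partial>torus) \<le> (\<integral>x. (t + (norm (trig_sum a A x))\<^sup>2 / t) / 2 \<partial>torus)"
  proof (rule integral_mono)
    show "norm (trig_sum a A x) \<le> (t + (norm (trig_sum a A x))\<^sup>2 / t) / 2" for x
      using sum_squares_ge_zero[of "t - norm (trig_sum a A x)" 0] assms(2)
      by (simp add: field_simps power2_eq_square)
  qed auto
  also have "\<dots> = (2 * pi * t + (2 * pi * (\<Sum>k\<in>A. (norm (a k))\<^sup>2)) / t) / 2"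
    by (simp add: parseval_trig_sum assms(1))
  also have "\<dots> \<le> (2 * pi * t + (2 * pi * t\<^sup>2) / t) / 2"
    using assms(2,3) by (intro divide_right_mono add_left_mono mult_left_mono) auto
  also have "\<dots> = 2 * pi * t" using assms(2) by (simp add: power2_eq_square)
  finally show ?thesis .
qed

text \<open>
  The partial sums along a fast subsequence \<open>r\<close> form a telescoping series whose terms have
  geometrically decreasing \<open>L\<^sup>1\<close> norms. Its pointwise sum \<open>g\<close> is therefore an almost everywhere and
  \<open>L\<^sup>1\<close> limit, which is enough to identify the coefficients. As a pointwise series of periodic
  functions, \<open>g\<close> is periodic everywhere and not only almost everywhere.
\<close>

theorem riesz_fischer:
  fixes a :: "int \<Rightarrow> complex"
  assumes "(\<lambda>k. (norm (a k))\<^sup>2) summable_on UNIV"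
  obtains g r where "g \<in> borel_measurable borel" "\<And>x. g (x + 2 * pi) = g x" "integrable torus g"
    "\<And>k. (\<integral>x. g x * mode (- k) x \<partial>torus) = 2 * of_real pi * a k"
    "AE x in torus. (\<lambda>j. trig_sum a {-int (r j)..int (r j)} x) \<longlonglongrightarrow> g x"
proof -
  define I where "I n = {-int n..int n}" for n
  define P where "P n = (\<Sum>k\<in>I n. (norm (a k))\<^sup>2)" for n
  have I_mono: "I m \<subseteq> I n" if "m \<le> n" for m n using that by (auto simp: I_def)
  have I_fin: "finite (I n)" for n by (simp add: I_def)
  have "P n \<le> (\<Sum>\<^sub>\<infinity>k. (norm (a k))\<^sup>2)" for n
    unfolding P_def by (rule finite_sum_le_infsum[OF assms]) (auto simp: I_fin)
  moreover have "mono P"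
    unfolding P_def mono_def by (auto intro!: sum_mono2 I_fin dest: I_mono)
  ultimately obtain L where "P \<longlonglongrightarrow> L"
    using incseq_convergent by blast
  then have "Cauchy P" by (rule LIMSEQ_imp_Cauchy)
  then have "\<exists>R. \<forall>m\<ge>R. \<forall>n\<ge>R. \<bar>P m - P n\<bar> < ((1 / 2) ^ j)\<^sup>2" for j
    by (auto simp: Cauchy_def dist_real_def)
  then obtain R where R: "\<And>j m n. R j \<le> m \<Longrightarrow> R j \<le> n \<Longrightarrow> \<bar>P m - P n\<bar> < ((1 / 2) ^ j)\<^sup>2"
    by metis
  \<comment> \<open>Adding up the moduli \<open>R i\<close> makes \<open>r\<close> increasing; the summand \<open>j\<close> makes it unbounded.\<close>
  define r where "r j = j + (\<Sum>i\<le>j. R i)" for j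
  have r_ge: "R j \<le> r j" and r_id: "j \<le> r j" and r_Suc: "r j \<le> r (Suc j)" for j
    unfolding r_def by (auto intro: trans_le_add2 member_le_sum)
  define D where "D j = (case j of 0 \<Rightarrow> trig_sum a (I (r 0))
    | Suc i \<Rightarrow> trig_sum a (I (r (Suc i)) - I (r i)))" for j
  define g where "g x = (\<Sum>j. D j x)" for x
  have partial: "(\<Sum>i<Suc j. D i x) = trig_sum a (I (r j)) x" for j x
  proof (induction j)
    case (Suc j)
    have "trig_sum a (I (r j)) x + trig_sum a (I (r (Suc j)) - I (r j)) x = trig_sum a (I (r (Suc j))) x"
      unfolding trig_sum_def
      by (rule trans[OF add.commute sum.subset_diff[OF I_mono[OF r_Suc] I_fin, symmetric]])
    then show ?case using Suc by (simp add: D_def)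
  qed (simp add: D_def)
  have D_meas [measurable]: "D j \<in> borel_measurable borel" for j
    by (cases j) (simp_all add: D_def)
  have D_int: "integrable torus (D j)" for j
    by (cases j) (simp_all add: D_def)
  have small: "(\<integral>x. norm (D (Suc j) x) \<partial>torus) \<le> 2 * pi * (1 / 2) ^ j" for j
  proof -
    have "(\<Sum>k\<in>I (r (Suc j)) - I (r j). (norm (a k))\<^sup>2) = P (r (Suc j)) - P (r j)"
      unfolding P_def by (intro sum_diff I_fin I_mono r_Suc)
    also have "\<dots> \<le> ((1 / 2) ^ j)\<^sup>2"
      using R[of j "r (Suc j)" "r j"] r_ge[of j] r_Suc[of j] by simp
    finally show ?thesis
      by (simp add: D_def integral_norm_trig_sum_le I_fin)
  qed
  have "summable (\<lambda>j. \<integral>x. norm (D (Suc j) x) \<partial>torus)"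
    by (rule summable_comparison_test'[of "\<lambda>j. 2 * pi * (1 / 2) ^ j" 0]) (use small in auto)
  then have D_sum: "summable (\<lambda>j. \<integral>x. norm (D j x) \<partial>torus)"
    by (subst (asm) summable_Suc_iff)
  have D_AE: "AE x in torus. summable (\<lambda>j. norm (D j x))"
    by (rule AE_summable_norm[OF D_int D_sum])
  show ?thesis
  proof
    show "g \<in> borel_measurable borel" unfolding g_def by measurable
    show "g (x + 2 * pi) = g x" for x
      unfolding g_def by (intro suminf_cong) (simp add: D_def split: nat.split)
    show "integrable torus g"
      unfolding g_def by (rule integrable_suminf[OF D_int D_AE D_sum])
    show "AE x in torus. (\<lambda>j. trig_sum a {-int (r j)..int (r j)} x) \<longlonglongrightarrow> g x"
      using D_AE
    proof eventually_elim
      case (elim x)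
      then have "(\<lambda>j. \<Sum>i<Suc j. D i x) \<longlonglongrightarrow> g x"
        unfolding g_def by (rule LIMSEQ_Suc[OF summable_LIMSEQ[OF summable_norm_cancel]])
      then show ?case by (simp only: partial I_def)
    qed
    fix k
    have Dk_int: "integrable torus (\<lambda>x. D j x * mode (- k) x)" for j
      by (intro integrable_mult_per_test D_int mode_per_test)
    have "(\<lambda>j. \<integral>x. D j x * mode (- k) x \<partial>torus) sums (\<integral>x. (\<Sum>j. D j x * mode (- k) x) \<partial>torus)"
      by (rule sums_integral) (use Dk_int D_AE D_sum in \<open>simp_all add: norm_mult\<close>)
    moreover have "(\<integral>x. (\<Sum>j. D j x * mode (- k) x) \<partial>torus) = (\<integral>x. g x * mode (- k) x \<partial>torus)"
    proof (rule integral_cong_AE)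
      show "AE x in torus. (\<Sum>j. D j x * mode (- k) x) = g x * mode (- k) x"
        using D_AE unfolding g_def
        by eventually_elim (simp add: suminf_mult2 summable_norm_cancel)
    qed (simp_all add: g_def measurable_torus)
    ultimately have "(\<lambda>j. \<Sum>i<j. \<integral>x. D i x * mode (- k) x \<partial>torus) \<longlonglongrightarrow> (\<integral>x. g x * mode (- k) x \<partial>torus)"
      by (simp add: sums_def)
    from LIMSEQ_Suc[OF this]
    have "(\<lambda>j. \<integral>x. trig_sum a (I (r j)) x * mode (- k) x \<partial>torus) \<longlonglongrightarrow> (\<integral>x. g x * mode (- k) x \<partial>torus)"
      by (simp only: Bochner_Integration.integral_sum[symmetric] Dk_int sum_distrib_right[symmetric] partial)
    moreover have "(\<lambda>j. \<integral>x. trig_sum a (I (r j)) x * mode (- k) x \<partial>torus) \<longlonglongrightarrow> 2 * of_real pi * a k"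
    proof (rule tendsto_eventually, rule eventually_sequentiallyI)
      fix j assume "nat \<bar>k\<bar> \<le> j"
      then have "k \<in> I (r j)" using r_id[of j] by (auto simp: I_def)
      then show "(\<integral>x. trig_sum a (I (r j)) x * mode (- k) x \<partial>torus) = 2 * of_real pi * a k"
        by (simp add: integral_trig_sum_mode I_fin)
    qed
    ultimately show "(\<integral>x. g x * mode (- k) x \<partial>torus) = 2 * of_real pi * a k"
      by (rule LIMSEQ_unique)
  qed
qed

lemma fourth_power_fatou:
  fixes g :: "real \<Rightarrow> complex"
  assumes [measurable]: "g \<in> borel_measurable torus" "\<And>j. S j \<in> borel_measurable torus"
    and int: "\<And>j. integrable torus (\<lambda>x. norm (S j x) ^ 4)"
    and lim: "AE x in torus. (\<lambda>j. S j x) \<longlonglongrightarrow> g x"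
    and K: "\<And>j. (\<integral>x. norm (S j x) ^ 4 \<partial>torus) \<le> K"
  shows "integrable torus (\<lambda>x. norm (g x) ^ 4)" "(\<integral>x. norm (g x) ^ 4 \<partial>torus) \<le> K"
proof -
  have K0: "0 \<le> K" by (rule order.trans[OF _ K[of 0]]) simp
  have "(\<integral>\<^sup>+x. ennreal (norm (g x) ^ 4) \<partial>torus) =
      (\<integral>\<^sup>+x. liminf (\<lambda>j. ennreal (norm (S j x) ^ 4)) \<partial>torus)"
  proof (rule nn_integral_cong_AE)
    show "AE x in torus. ennreal (norm (g x) ^ 4) = liminf (\<lambda>j. ennreal (norm (S j x) ^ 4))"
      using lim
    proof eventually_elim
      case (elim x)
      then have "(\<lambda>j. ennreal (norm (S j x) ^ 4)) \<longlonglongrightarrow> ennreal (norm (g x) ^ 4)"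
        by (intro tendsto_ennrealI tendsto_intros)
      then show ?case by (intro lim_imp_Liminf[symmetric]) auto
    qed
  qed
  also have "\<dots> \<le> liminf (\<lambda>j. \<integral>\<^sup>+x. ennreal (norm (S j x) ^ 4) \<partial>torus)"
    by (rule nn_integral_liminf) measurable
  also have "\<dots> \<le> liminf (\<lambda>j::nat. ennreal K)"
    by (intro Liminf_mono always_eventually allI)
      (simp add: nn_integral_eq_integral int K ennreal_leI)
  also have "\<dots> = ennreal K" by (simp add: Liminf_const)
  finally have le: "(\<integral>\<^sup>+x. ennreal (norm (g x) ^ 4) \<partial>torus) \<le> ennreal K" .
  then have "(\<integral>\<^sup>+x. ennreal (norm (norm (g x) ^ 4)) \<partial>torus) < \<infinity>"
    by (simp add: le_less_trans[OF _ ennreal_less_top])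
  then show int_g: "integrable torus (\<lambda>x. norm (g x) ^ 4)"
    by (intro integrableI_bounded) measurable
  show "(\<integral>x. norm (g x) ^ 4 \<partial>torus) \<le> K"
    using le K0 by (simp add: nn_integral_eq_integral[OF int_g] ennreal_le_iff)
qed

section \<open>Sobolev distributions and the interpolation inequality\<close>

lemma summable_powr_weights:
  fixes a :: "int \<Rightarrow> complex"
  assumes "0 < s" "(\<lambda>k::int. (1 + (of_int k)\<^sup>2) powr s * (norm (a k))\<^sup>2) summable_on UNIV"
  shows "(\<lambda>k. (norm (a k))\<^sup>2) summable_on UNIV"
    and "(\<lambda>k. \<bar>of_int k\<bar> powr (2 * s) * (norm (a k))\<^sup>2) summable_on UNIV"
proof -
  have 1: "1 * (norm (a k))\<^sup>2 \<le> (1 + (of_int k)\<^sup>2) powr s * (norm (a k))\<^sup>2" for k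
    using assms(1) by (intro mult_right_mono ge_one_powr_ge_zero) auto
  show "(\<lambda>k. (norm (a k))\<^sup>2) summable_on UNIV"
    by (rule summable_on_comparison_test[OF assms(2)]) (use 1 in auto)
  have "\<bar>of_int k\<bar> powr (2 * s) \<le> (1 + (of_int k)\<^sup>2 :: real) powr s" for k :: int
  proof -
    have "\<bar>of_int k :: real\<bar> powr (2 * s) = (\<bar>of_int k\<bar> powr 2) powr s"
      by (simp only: powr_powr)
    also have "\<dots> = ((of_int k)\<^sup>2) powr s" by simp
    also have "\<dots> \<le> (1 + (of_int k)\<^sup>2) powr s" using assms(1) by (intro powr_mono2) auto
    finally show ?thesis .
  qed
  then show "(\<lambda>k. \<bar>of_int k\<bar> powr (2 * s) * (norm (a k))\<^sup>2) summable_on UNIV"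
    by (intro summable_on_comparison_test[OF assms(2)] mult_right_mono) auto
qed

text \<open>
  The definite description has a value because the coefficients \<open>\<bar>k\<bar>\<^sup>s a\<^sub>k\<close> are square summable,
  so that Riesz--Fischer provides a distribution with these coefficients.
\<close>

lemma fourier_coeff_frac_lap_half:
  assumes s: "0 < s" and f: "f \<in> H_per s"
  shows "fourier_coeff (frac_lap_half s f) k = of_real (\<bar>of_int k\<bar> powr s) * fourier_coeff f k"
proof -
  define b where "b k = of_real (\<bar>of_int k\<bar> powr s) * fourier_coeff f k" for k
  have "(norm (b k))\<^sup>2 = \<bar>of_int k\<bar> powr (2 * s) * (norm (fourier_coeff f k))\<^sup>2" for k
    by (simp add: b_def norm_mult power_mult_distrib power2_eq_square[of "_ powr s"] flip: powr_add)
  then have "(\<lambda>k. (norm (b k))\<^sup>2) summable_on UNIV"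
    using summable_powr_weights(2)[OF s] f by (simp add: H_per_def)
  then obtain h where h: "integrable torus h"
      "\<And>k. (\<integral>x. h x * mode (- k) x \<partial>torus) = 2 * of_real pi * b k"
    by (rule riesz_fischer) blast
  let ?P = "\<lambda>v. v \<in> per_distr \<and>
    (\<forall>k. fourier_coeff v k = of_real (\<bar>of_int k\<bar> powr s) * fourier_coeff f k)"
  have P: "?P (distr_of h)"
    using h by (simp add: distr_of_per_distr fourier_coeff_distr_of b_def)
  moreover have "v = distr_of h" if "?P v" for v
    using that P by (intro per_distr_eqI) auto
  ultimately have "?P (frac_lap_half s f)"
    unfolding frac_lap_half_def by (rule theI)
  then show ?thesis by blast
qed

lemma L2_norm_square:
  "(L2_norm u)\<^sup>2 = 2 * pi * (\<Sum>\<^sub>\<infinity>k. (norm (fourier_coeff u k))\<^sup>2)"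
proof -
  have "(1 + (of_int k)\<^sup>2 :: real) powr 0 = 1" for k :: int
    using powr_zero_eq_one[of "1 + (of_int k)\<^sup>2 :: real"] by (simp add: add_nonneg_eq_0_iff)
  then show ?thesis
    by (simp add: H_norm_def infsum_nonneg)
qed

lemma L2_norm_nonneg: "0 \<le> L2_norm u"
  by (simp add: H_norm_def infsum_nonneg)

text \<open>
The factor \<open>2 pi\<close> in the square of the norm is at least 1 and is simply dropped.
\<close>

lemma sum_le_L2_norm_square:
  assumes "(\<lambda>k. (norm (fourier_coeff u k))\<^sup>2) summable_on UNIV" "finite A"
  shows "(\<Sum>k\<in>A. (norm (fourier_coeff u k))\<^sup>2) \<le> (L2_norm u)\<^sup>2"
proof -
  let ?T = "\<Sum>\<^sub>\<infinity>k. (norm (fourier_coeff u k))\<^sup>2"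
  have "(\<Sum>k\<in>A. (norm (fourier_coeff u k))\<^sup>2) \<le> ?T"
    by (rule finite_sum_le_infsum[OF assms]) auto
  also have "?T = 1 * ?T" by simp
  also have "\<dots> \<le> 2 * pi * ?T"
    using pi_gt3 by (intro mult_right_mono) (auto intro: infsum_nonneg)
  finally show ?thesis by (simp only: L2_norm_square)
qed

lemma integral_partial_sum_fourth_power_le:
  assumes s: "1 / 4 < s" "s < 1" and f: "f \<in> H_per s"
  shows "(\<integral>x. norm (trig_sum (fourier_coeff f) {-int N..int N} x) ^ 4 \<partial>torus) \<le>
    2 * pi * (2 * (8 + 2 * (\<Sum>q. real (Suc q) powr - (4 * s))) ^ 3 *
      (L2_norm f ^ 4 + L2_norm (frac_lap_half s f) powr (1 / s) * L2_norm f powr (4 - 1 / s)))"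
proof -
  let ?a = "fourier_coeff f" and ?v = "frac_lap_half s f"
  define c where "c k = root 3 (norm (?a k))" for k
  have c6: "c k ^ 6 = (norm (?a k))\<^sup>2" for k
  proof -
    have "c k ^ 6 = (c k ^ 3) ^ 2" by (simp flip: power_mult)
    then show ?thesis by (simp add: c_def)
  qed
  have v: "(norm (fourier_coeff ?v k))\<^sup>2 = \<bar>of_int k\<bar> powr (2 * s) * (norm (?a k))\<^sup>2" for k
    using s f by (simp add: fourier_coeff_frac_lap_half norm_mult power_mult_distrib
        power2_eq_square[of "_ powr s"] flip: powr_add)
  have sum: "(\<lambda>k. (norm (?a k))\<^sup>2) summable_on UNIV"
    "(\<lambda>k. (norm (fourier_coeff ?v k))\<^sup>2) summable_on UNIV"
    using summable_powr_weights[of s ?a] s f by (simp_all add: H_per_def v)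
  have "(\<Sum>k\<in>{-int N..int N}. c k ^ 4) ^ 3 \<le> 2 * (8 + 2 * (\<Sum>q. real (Suc q) powr - (4 * s))) ^ 3 *
      (L2_norm f ^ 4 + L2_norm ?v powr (1 / s) * L2_norm f powr (4 - 1 / s))"
    using sum_le_L2_norm_square[OF sum(1)] sum_le_L2_norm_square[OF sum(2)]
    by (intro sum_fourth_power_cube_le s) (simp_all add: c6 v L2_norm_nonneg, simp add: c_def)
  then have "2 * pi * (\<Sum>k\<in>{-int N..int N}. c k ^ 4) ^ 3 \<le>
      2 * pi * (2 * (8 + 2 * (\<Sum>q. real (Suc q) powr - (4 * s))) ^ 3 *
      (L2_norm f ^ 4 + L2_norm ?v powr (1 / s) * L2_norm f powr (4 - 1 / s)))"
    by (intro mult_left_mono) auto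
  then show ?thesis
    using integral_trig_sum_fourth_power_le[of ?a N] unfolding c_def by linarith
qed

lemma Lp_represents_fourier:
  assumes "Lp_represents p g u"
  shows "g \<in> borel_measurable borel" "integrable torus g"
    "(\<integral>x. g x * mode k x \<partial>torus) = u (mode k)"
  using assms mode_per_test[of k]
  by (auto simp: Lp_represents_def set_integrable_torus set_integral_torus)

lemma Lp_represents_AE_unique:
  assumes g: "Lp_represents p g u" and g': "Lp_represents p g' u"
  shows "AE x in torus. g x = g' x"
proof -
  have int: "integrable torus (\<lambda>x. g x * mode k x)" "integrable torus (\<lambda>x. g' x * mode k x)" for k
    using Lp_represents_fourier(2)[OF g] Lp_represents_fourier(2)[OF g']
    by (auto intro: integrable_mult_per_test mode_per_test)
  have "AE x in torus. g x - g' x = 0"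
  proof (rule AE_eq_0_if_fourier_coeffs_0)
    show "integrable torus (\<lambda>x. g x - g' x)"
      by (intro Bochner_Integration.integrable_diff Lp_represents_fourier(2)[OF g] Lp_represents_fourier(2)[OF g'])
    show "(\<integral>x. (g x - g' x) * mode k x \<partial>torus) = 0" for k
      by (simp add: left_diff_distrib int Lp_represents_fourier(3)[OF g] Lp_represents_fourier(3)[OF g'])
  qed
  then show ?thesis by eventually_elim simp
qed

text \<open>
  The norm is evaluated at a representative picked by Hilbert choice; by uniqueness almost
  everywhere, any representative may be used in its place.
\<close>

lemma Lp_norm_eq:
  assumes g: "Lp_represents p g u"
  shows "Lp_norm p u = (\<integral>x. norm (g x) powr p \<partial>torus) powr (1 / p)"
proof -
  let ?g' = "SOME g. Lp_represents p g u"
  have g': "Lp_represents p ?g' u" using g by (rule someI[of "\<lambda>g. Lp_represents p g u"])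
  have [measurable]: "g \<in> borel_measurable torus" "?g' \<in> borel_measurable torus"
    by (intro measurable_torus Lp_represents_fourier(1)[OF g] Lp_represents_fourier(1)[OF g'])+
  have "(\<integral>x. norm (?g' x) powr p \<partial>torus) = (\<integral>x. norm (g x) powr p \<partial>torus)"
  proof (rule integral_cong_AE)
    show "AE x in torus. norm (?g' x) powr p = norm (g x) powr p"
      using Lp_represents_AE_unique[OF g' g] by eventually_elim simp
  qed measurable
  then show ?thesis by (simp only: Lp_norm_def set_integral_torus)
qed

theorem corollary3p4:
  fixes s :: real
  assumes "1 / 4 < s" and "s < 1"
  shows "\<exists>C\<^sub>4 > 0. \<forall>f \<in> H_per s. f \<in> Lp_per 4 \<and>
    Lp_norm 4 f ^ 4 \<le>
      C\<^sub>4 * L2_norm (frac_lap_half s f) powr (1 / s) * L2_norm f powr (4 - 1 / s)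
      + C\<^sub>4 * L2_norm f ^ 4"
proof -
  define \<zeta> where "\<zeta> = (\<Sum>q. real (Suc q) powr - (4 * s))"
  define C where "C = 4 * pi * (8 + 2 * \<zeta>) ^ 3"
  have "0 \<le> \<zeta>"
    unfolding \<zeta>_def using assms by (intro suminf_nonneg summable_Suc_powr) auto
  then have C0: "C > 0" by (simp add: C_def)
  have "f \<in> Lp_per 4 \<and> Lp_norm 4 f ^ 4 \<le>
      C * L2_norm (frac_lap_half s f) powr (1 / s) * L2_norm f powr (4 - 1 / s) + C * L2_norm f ^ 4"
    if f: "f \<in> H_per s" for f
  proof -
    let ?a = "fourier_coeff f"
    define K where "K = C * L2_norm (frac_lap_half s f) powr (1 / s) * L2_norm f powr (4 - 1 / s)
      + C * L2_norm f ^ 4"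
    have K: "(\<integral>x. norm (trig_sum ?a {-int N..int N} x) ^ 4 \<partial>torus) \<le> K" for N
      using integral_partial_sum_fourth_power_le[OF assms f, of N]
      by (simp add: K_def C_def \<zeta>_def algebra_simps)
    have fd: "f \<in> per_distr" using f by (simp add: H_per_def)
    have "(\<lambda>k. (norm (?a k))\<^sup>2) summable_on UNIV"
      using summable_powr_weights(1)[of s ?a] assms f by (simp add: H_per_def)
    then obtain g r where g: "g \<in> borel_measurable borel" "\<And>x. g (x + 2 * pi) = g x"
        "integrable torus g" "\<And>k. (\<integral>x. g x * mode (- k) x \<partial>torus) = 2 * of_real pi * ?a k"
      and lim: "AE x in torus. (\<lambda>j. trig_sum ?a {-int (r j)..int (r j)} x) \<longlonglongrightarrow> g x"
      by (rule riesz_fischer) blast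
    have g4: "integrable torus (\<lambda>x. norm (g x) ^ 4)" "(\<integral>x. norm (g x) ^ 4 \<partial>torus) \<le> K"
      using fourth_power_fatou[OF measurable_torus[OF g(1)] measurable_torus _ lim K] by simp_all
    have "f = distr_of g"
      by (intro per_distr_eqI fd distr_of_per_distr g(3)) (simp add: fourier_coeff_distr_of g(4))
    then have rep: "Lp_represents 4 g f"
      using g g4(1) by (simp add: Lp_represents_def set_integrable_torus set_integral_torus distr_of_def)
    have "Lp_norm 4 f ^ 4 = ((\<integral>x. norm (g x) ^ 4 \<partial>torus) powr (1 / 4)) powr 4"
      by (simp add: Lp_norm_eq[OF rep])
    also have "\<dots> = (\<integral>x. norm (g x) ^ 4 \<partial>torus)"
      by (simp only: powr_powr) simp
    finally show ?thesis
      using rep fd g4(2) by (auto simp: Lp_per_def K_def)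
  qed
  then show ?thesis using C0 by blast
qed

end
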